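(* Let $\Omega\in\mathrm{RTSeq}_n$. The torus-orbit closures contained in $X(\Omega)$ (for the diagonal torus acting on $\mathrm{Fl}_n$) are exactly the varieties $X(\Omega')$, where $\Omega'$ is obtained from $\Omega$ by choosing a subset of the letters of $\Omega$ of the form $T_i$ and replacing each chosen letter $T_i$ independently by either $R_i$ or $R_{i+1}$.
   Context: $\mathrm{Fl}_n=GL_n(\mathbb C)/B$, $X^w=\overline{BwB/B}$, $X_w=\overline{B^-wB/B}$ ($B$, $B^-$ upper/lower triangular), Richardson $X^v_u=X^v\cap X_u$. For $w\in S_m$, $1\le i\le m+1$, $\epsilon_i(w)\in S_{m+1}$: $\epsilon_i(w)(j)=w(j)+1$ ($j<i$), $1$ ($j=i$), $w(j-1)+1$ ($j>i$). $\mathrm{RTSeq}_n$ is the set of words $X_1\cdots X_n$ in formal letters with $X_i\in\{R_1,T_1,\dots,R_{i-1},T_{i-1},R_i\}$; $u(\emptyset)=v(\emptyset)=\mathrm{id}$, $(u,v)(\Omega'R_j)=(\epsilon_ju(\Omega'),\epsilon_jv(\Omega'))$, $(u,v)(\Omega'T_j)=(\epsilon_ju(\Omega'),\epsilon_{j+1}v(\Omega'))$; $X(\Omega)=X^{v(\Omega)}_{u(\Omega)}$. *)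

theory Defs
  imports "HOL-Analysis.Analysis" "HOL-Combinatorics.Permutations"
begin

text \<open>An n x n complex matrix is a function nat => nat => complex that vanishes
outside the block {0..<n} x {0..<n}. The function space carries the product
topology (HOL-Analysis Function_Topology); restricted to matrices this is the
usual Euclidean topology of the space of n x n complex matrices.\<close>

type_synonym cmat = "nat \<Rightarrow> nat \<Rightarrow> complex"

definition mats :: "nat \<Rightarrow> cmat set" where
  "mats n = {A. \<forall>i j. (n \<le> i \<or> n \<le> j) \<longrightarrow> A i j = 0}"

definition mmul :: "nat \<Rightarrow> cmat \<Rightarrow> cmat \<Rightarrow> cmat" where
  "mmul n A B = (\<lambda>i j. if i < n \<and> j < n then (\<Sum>k<n. A i k * B k j) else 0)"

definition mdet :: "nat \<Rightarrow> cmat \<Rightarrow> complex" where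
  "mdet n A = (\<Sum>p | p permutes {..<n}. of_int (sign p) * (\<Prod>i<n. A i (p i)))"

definition GLn :: "nat \<Rightarrow> cmat set" where
  "GLn n = {A \<in> mats n. mdet n A \<noteq> 0}"

definition Bup :: "nat \<Rightarrow> cmat set" where
  "Bup n = {A \<in> GLn n. \<forall>i j. j < i \<longrightarrow> A i j = 0}"

definition Blow :: "nat \<Rightarrow> cmat set" where
  "Blow n = {A \<in> GLn n. \<forall>i j. i < j \<longrightarrow> A i j = 0}"

definition Torus :: "nat \<Rightarrow> cmat set" where
  "Torus n = {A \<in> GLn n. \<forall>i j. i \<noteq> j \<longrightarrow> A i j = 0}"

text \<open>Permutation matrix of w in S_n: entry 1 at (w(j), j) (1-based), so that
w B/B is the coordinate flag spanned by e_{w(1)}, e_{w(2)}, ...\<close>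
definition pmat :: "nat \<Rightarrow> (nat \<Rightarrow> nat) \<Rightarrow> cmat" where
  "pmat n w = (\<lambda>i j. if i < n \<and> j < n \<and> Suc i = w (Suc j) then 1 else 0)"

definition eps :: "nat \<Rightarrow> nat \<Rightarrow> (nat \<Rightarrow> nat) \<Rightarrow> (nat \<Rightarrow> nat)" where
  "eps m i w = (\<lambda>j. if j < 1 \<or> Suc m < j then j
                    else if j < i then w j + 1
                    else if j = i then 1
                    else w (j - 1) + 1)"

text \<open>A subset S of Fl_n = GL_n/B is represented by its preimage in GL_n.
Since the quotient map is open, the preimage of a closure is the closure
(relative to GL_n) of the preimage.\<close>

definition setmul3 :: "nat \<Rightarrow> cmat set \<Rightarrow> cmat \<Rightarrow> cmat set \<Rightarrow> cmat set" where
  "setmul3 n P g Q = {mmul n (mmul n p g) q | p q. p \<in> P \<and> q \<in> Q}"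

definition SchubUp :: "nat \<Rightarrow> (nat \<Rightarrow> nat) \<Rightarrow> cmat set" where
  "SchubUp n w = GLn n \<inter> closure (setmul3 n (Bup n) (pmat n w) (Bup n))"

definition SchubLow :: "nat \<Rightarrow> (nat \<Rightarrow> nat) \<Rightarrow> cmat set" where
  "SchubLow n w = GLn n \<inter> closure (setmul3 n (Blow n) (pmat n w) (Bup n))"

definition Richardson :: "nat \<Rightarrow> (nat \<Rightarrow> nat) \<Rightarrow> (nat \<Rightarrow> nat) \<Rightarrow> cmat set" where
  "Richardson n u v = SchubUp n v \<inter> SchubLow n u"

definition torus_orbit_closure :: "nat \<Rightarrow> cmat \<Rightarrow> cmat set" where
  "torus_orbit_closure n g = GLn n \<inter> closure (setmul3 n (Torus n) g (Bup n))"

datatype letter = R nat | T nat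

text \<open>Position k (1-based) of a word X_1...X_n holds R_j (1 <= j <= k)
or T_j (1 <= j <= k-1).\<close>
definition RTSeq :: "nat \<Rightarrow> letter list set" where
  "RTSeq n = {\<Omega>. length \<Omega> = n \<and>
     (\<forall>k < n. case \<Omega> ! k of R j \<Rightarrow> 1 \<le> j \<and> j \<le> Suc k
                          | T j \<Rightarrow> 1 \<le> j \<and> j \<le> k)}"

fun uv_rev :: "letter list \<Rightarrow> (nat \<Rightarrow> nat) \<times> (nat \<Rightarrow> nat)" where
  "uv_rev [] = (id, id)"
| "uv_rev (R j # xs) = (case uv_rev xs of (u, v) \<Rightarrow>
      (eps (length xs) j u, eps (length xs) j v))"
| "uv_rev (T j # xs) = (case uv_rev xs of (u, v) \<Rightarrow>
      (eps (length xs) j u, eps (length xs) (Suc j) v))"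

definition uv :: "letter list \<Rightarrow> (nat \<Rightarrow> nat) \<times> (nat \<Rightarrow> nat)" where
  "uv \<Omega> = uv_rev (rev \<Omega>)"

definition Xvar :: "letter list \<Rightarrow> cmat set" where
  "Xvar \<Omega> = Richardson (length \<Omega>) (fst (uv \<Omega>)) (snd (uv \<Omega>))"

definition resolutions :: "letter list \<Rightarrow> letter list set" where
  "resolutions \<Omega> = {\<Omega>'. length \<Omega>' = length \<Omega> \<and>
     (\<forall>k < length \<Omega>. \<Omega>' ! k = \<Omega> ! k \<or>
        (\<exists>i. \<Omega> ! k = T i \<and> (\<Omega>' ! k = R i \<or> \<Omega>' ! k = R (Suc i))))}"

end

theory Submission
  imports Defs "Jordan_Normal_Form.Determinant"
begin

text \<open>Appending a letter turns a Richardson variety of \<open>n\<close> by \<open>n\<close> matrices into one of size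
\<open>n + 1\<close> in an explicit way. Let \<open>ins 0 j A\<close> be \<open>A\<close> with a new first row and a new column \<open>j\<close>
meeting in a 1. Then \<open>R\<close> replaces \<open>X\<close> by \<open>ins 0 j X \<cdot> B\<close>, and \<open>T\<close> replaces \<open>X\<close> by
\<open>ins 0 j X \<cdot> P\<close> with \<open>P\<close> the minimal parabolic acting on columns \<open>j\<close> and \<open>j + 1\<close>, that is, by
a bundle of projective lines over \<open>X\<close>. A flag in the larger variety has its
\<open>j\<close>-dimensional member inside the hyperplane \<open>x\<^sub>1 = 0\<close> and the first coordinate vector in
its \<open>(j + 1)\<close>- or \<open>(j + 2)\<close>-dimensional member; these closed conditions produce the factorization,
and the smaller flag is recovered by a polynomial map, so that it stays in the closure of the
smaller cell. Each projective line splits under the torus into two fixed points, which are the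
two resolutions of \<open>T\<close>, and one open orbit. Hence \<open>X(\<Omega>)\<close> is the union of one torus orbit for
each resolution of \<open>\<Omega>\<close>, and the closure of that orbit is the variety of the resolution.\<close>

subsection \<open>Linear algebra\<close>

text \<open>The obstacle is that Schubert varieties are given as closures, with no equations at
  hand. Claims about them are therefore checked on the cell and carried over by a polynomial map or
  by a limit in a parameter. The maps that recover the smaller flag must be defined on all matrices
  and need not preserve invertibility, so on the cell their values are only claimed to lie in the
  closure of the smaller cell; \<open>upper_closure_Bup\<close> pays for this. Two maps are needed:
  deleting the first row and column \<open>j\<close> commutes with an upper triangular factor on the
  left but not with a lower triangular one, and there a Schur complement takes over. Both return
  \<open>A\<close> from \<open>ins 0 j A\<close>, so the two closure conditions reach the same
  smaller flag. The orbits are built by the same recursion as the varieties; transitivity comes from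
  the one new torus coordinate, which scales the ratio \<alpha>:\<beta> on each projective
  line.\<close>

definition idm :: "nat \<Rightarrow> cmat" where
  "idm n = (\<lambda>i j. if i < n \<and> i = j then 1 else 0)"

definition upper :: "nat \<Rightarrow> cmat set" where
  "upper n = {A \<in> mats n. \<forall>i j. j < i \<longrightarrow> A i j = 0}"

lemma mats_eqI:
  assumes "A \<in> mats n" "B \<in> mats n" "\<And>i j. i < n \<Longrightarrow> j < n \<Longrightarrow> A i j = B i j"
  shows "A = B"
proof (intro ext)
  fix i j show "A i j = B i j"
    using assms by (cases "i < n \<and> j < n") (auto simp: mats_def)
qed

lemma mmul_mats [simp]: "mmul n A B \<in> mats n"
  by (auto simp: mats_def mmul_def)

lemma idm_mats [simp]: "idm n \<in> mats n"
  by (auto simp: mats_def idm_def)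

lemma mmul_assoc: "mmul n (mmul n A B) C = mmul n A (mmul n B C)"
proof (rule mats_eqI[of _ n])
  fix i j assume ij: "i < n" "j < n"
  have "mmul n (mmul n A B) C i j = (\<Sum>k<n. \<Sum>l<n. A i l * B l k * C k j)"
    using ij by (simp add: mmul_def sum_distrib_right)
  also have "\<dots> = (\<Sum>l<n. \<Sum>k<n. A i l * B l k * C k j)" by (rule sum.swap)
  also have "\<dots> = mmul n A (mmul n B C) i j"
    using ij by (simp add: mmul_def sum_distrib_left mult.assoc)
  finally show "mmul n (mmul n A B) C i j = mmul n A (mmul n B C) i j" .
qed simp_all

lemma mmul_idm_left [simp]: "A \<in> mats n \<Longrightarrow> mmul n (idm n) A = A"
  by (rule mats_eqI[of _ n]) (simp_all, simp_all add: mmul_def idm_def if_distrib[of "\<lambda>x. x * _"] cong: if_cong)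

lemma mmul_idm_right [simp]: "A \<in> mats n \<Longrightarrow> mmul n A (idm n) = A"
  by (rule mats_eqI[of _ n]) (simp_all, simp_all add: mmul_def idm_def if_distrib[of "\<lambda>x. _ * x"] cong: if_cong)

lemma mdet_eq_det: "mdet n A = Determinant.det (Matrix.mat n n (\<lambda>(i, j). A i j))"
proof -
  have "(\<Prod>i<n. A i (p i)) = (\<Prod>i = 0..<n. Matrix.mat n n (\<lambda>(i, j). A i j) $$ (i, p i))"
    if "p permutes {0..<n}" for p
    using permutes_in_image[OF that] by (intro prod.cong) (auto simp: lessThan_atLeast0)
  then show ?thesis
    unfolding mdet_def by (subst det_def'[of _ n]) (auto simp: lessThan_atLeast0 intro!: sum.cong)
qed

lemma mat_mmul: "Matrix.mat n n (\<lambda>(i, j). mmul n A B i j) =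
    Matrix.mat n n (\<lambda>(i, j). A i j) * Matrix.mat n n (\<lambda>(i, j). B i j)"
  by (rule eq_matI) (auto simp: mmul_def scalar_prod_def lessThan_atLeast0)

lemma mat_idm: "Matrix.mat n n (\<lambda>(i, j). idm n i j) = 1\<^sub>m n"
  by (rule eq_matI) (auto simp: idm_def)

lemma mdet_mmul: "mdet n (mmul n A B) = mdet n A * mdet n B"
  unfolding mdet_eq_det mat_mmul by (rule det_mult[of _ n]) auto

lemma mdet_idm: "mdet n (idm n) = 1"
  unfolding mdet_eq_det mat_idm by simp

lemma GLn_mmul: "A \<in> GLn n \<Longrightarrow> B \<in> GLn n \<Longrightarrow> mmul n A B \<in> GLn n"
  by (auto simp: GLn_def mdet_mmul)

lemma GLnI_right_inverse:
  assumes "A \<in> mats n" "mmul n A B = idm n"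
  shows "A \<in> GLn n"
proof -
  have "mdet n A * mdet n B = 1" using assms(2) by (metis mdet_mmul mdet_idm)
  then show ?thesis using assms(1) by (auto simp: GLn_def)
qed

lemma GLn_inverse:
  assumes "A \<in> GLn n"
  obtains B where "B \<in> GLn n" "mmul n A B = idm n" "mmul n B A = idm n"
proof -
  let ?A = "Matrix.mat n n (\<lambda>(i, j). A i j)"
  have "Determinant.det ?A \<noteq> 0" using assms by (auto simp: GLn_def mdet_eq_det)
  from det_non_zero_imp_unit[OF _ this, of n "()"]
  obtain B where B: "B \<in> carrier_mat n n" "?A * B = 1\<^sub>m n" "B * ?A = 1\<^sub>m n"
    by (auto simp: Units_def ring_mat_def)
  define B' where "B' = (\<lambda>i j. if i < n \<and> j < n then B $$ (i, j) else 0)"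
  have BB: "Matrix.mat n n (\<lambda>(i, j). B' i j) = B"
    using B(1) by (intro eq_matI) (auto simp: B'_def)
  have eq: "C = D" if "Matrix.mat n n (\<lambda>(i, j). C i j) = Matrix.mat n n (\<lambda>(i, j). D i j)"
    "C \<in> mats n" "D \<in> mats n" for C D :: cmat
  proof (rule mats_eqI[OF that(2,3)])
    fix i j assume ij: "i < n" "j < n"
    have "Matrix.mat n n (\<lambda>(i, j). C i j) $$ (i, j) = Matrix.mat n n (\<lambda>(i, j). D i j) $$ (i, j)"
      using that(1) by simp
    then show "C i j = D i j" using ij by simp
  qed
  have 1: "mmul n A B' = idm n"
    by (rule eq) (simp_all add: mat_mmul mat_idm BB B)
  have 2: "mmul n B' A = idm n"
    by (rule eq) (simp_all add: mat_mmul mat_idm BB B)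
  have "B' \<in> mats n" by (auto simp: B'_def mats_def)
  then have "B' \<in> GLn n" using 2 by (rule GLnI_right_inverse)
  then show thesis using 1 2 that by blast
qed

lemma prod_list_diag_mat:
  "prod_list (diag_mat (Matrix.mat n n (\<lambda>(i, j). A i j))) = (\<Prod>i<n. A i i)"
proof -
  have "prod_list (diag_mat (Matrix.mat n n (\<lambda>(i, j). A i j))) = (\<Prod>i\<leftarrow>[0..<n]. A i i)"
    by (auto simp: diag_mat_def intro!: arg_cong[of _ _ prod_list])
  also have "\<dots> = (\<Prod>i<n. A i i)"
    by (simp add: prod.distinct_set_conv_list[symmetric] lessThan_atLeast0)
  finally show ?thesis .
qed

lemma mdet_upper:
  assumes "\<And>i j. j < i \<Longrightarrow> A i j = 0"
  shows "mdet n A = (\<Prod>i<n. A i i)"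
  unfolding mdet_eq_det prod_list_diag_mat[symmetric]
  by (rule det_upper_triangular[of _ n]) (use assms in auto)

lemma mdet_lower:
  assumes "\<And>i j. i < j \<Longrightarrow> A i j = 0"
  shows "mdet n A = (\<Prod>i<n. A i i)"
  unfolding mdet_eq_det prod_list_diag_mat[symmetric]
  by (rule det_lower_triangular[of n]) (use assms in auto)

lemma Bup_iff: "A \<in> Bup n \<longleftrightarrow> A \<in> upper n \<and> (\<forall>i<n. A i i \<noteq> 0)"
  using mdet_upper[of A n] by (auto simp: Bup_def GLn_def upper_def)

lemma Blow_iff:
  "A \<in> Blow n \<longleftrightarrow> A \<in> mats n \<and> (\<forall>i j. i < j \<longrightarrow> A i j = 0) \<and> (\<forall>i<n. A i i \<noteq> 0)"
  using mdet_lower[of A n] by (auto simp: Blow_def GLn_def)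

lemma Torus_iff:
  "A \<in> Torus n \<longleftrightarrow> A \<in> mats n \<and> (\<forall>i j. i \<noteq> j \<longrightarrow> A i j = 0) \<and> (\<forall>i<n. A i i \<noteq> 0)"
  using mdet_lower[of A n] by (auto simp: Torus_def GLn_def)

lemma Bup_GLn: "A \<in> Bup n \<Longrightarrow> A \<in> GLn n"
  by (simp add: Bup_def)

lemma GLn_mats: "A \<in> GLn n \<Longrightarrow> A \<in> mats n"
  by (simp add: GLn_def)

lemma Bup_mats: "A \<in> Bup n \<Longrightarrow> A \<in> mats n"
  by (simp add: Bup_def GLn_def)

lemma idm_Bup: "idm n \<in> Bup n"
  by (auto simp: Bup_iff upper_def idm_def mats_def)

lemma idm_Torus: "idm n \<in> Torus n"
  by (auto simp: Torus_iff idm_def mats_def)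

lemma upper_mmul: "A \<in> upper n \<Longrightarrow> B \<in> upper n \<Longrightarrow> mmul n A B \<in> upper n"
proof -
  assume A: "A \<in> upper n" and B: "B \<in> upper n"
  have "A i k * B k j = 0" if "j < i" for i j k
    using A B that by (cases "k < i") (auto simp: upper_def)
  then show ?thesis by (auto simp: upper_def) (auto simp: mmul_def intro!: sum.neutral)
qed

lemma Bup_mmul: "A \<in> Bup n \<Longrightarrow> B \<in> Bup n \<Longrightarrow> mmul n A B \<in> Bup n"
  using upper_mmul[of A n B] GLn_mmul[of A n B] by (auto simp: Bup_def upper_def GLn_def)

lemma Blow_mmul: 
  assumes A: "A \<in> Blow n" and B: "B \<in> Blow n"
  shows "mmul n A B \<in> Blow n"
proof -
  have "A i k * B k j = 0" if "i < j" for i j k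
    using A B that by (cases "k < j") (auto simp: Blow_def)
  then show ?thesis using GLn_mmul[of A n B] A B
    by (auto simp: Blow_def) (auto simp: mmul_def intro!: sum.neutral)
qed

lemma Bup_inverse:
  assumes "A \<in> Bup n"
  obtains B where "B \<in> Bup n" "mmul n A B = idm n" "mmul n B A = idm n"
proof -
  obtain B where B: "B \<in> GLn n" "mmul n A B = idm n" "mmul n B A = idm n"
    using GLn_inverse assms by (auto simp: Bup_def)
  have A: "A k l = 0" if "l < k" for k l using that assms by (auto simp: Bup_def)
  have A0: "A i i \<noteq> 0" if "i < n" for i using that assms by (auto simp: Bup_iff)
  \<comment> \<open>Back substitution from the last row upwards: once the rows \<open>k > i\<close>
    of column \<open>j\<close> vanish, entry \<open>(i, j)\<close> of \<open>A B = 1\<close> reads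
    \<open>A i i * B i j = 0\<close>.\<close>
  have "B i j = 0" if "j < i" for i j
    using that
  proof (induction "n - i" arbitrary: i rule: less_induct)
    case less
    show ?case
    proof (cases "i < n")
      case True
      have "A i k * B k j = (if k = i then A i i * B i j else 0)" if "k < n" for k
        using less.hyps[of k] less.prems that True A[of k i] by (cases "k < i") auto
      then have "(\<Sum>k<n. A i k * B k j) = (\<Sum>k<n. if k = i then A i i * B i j else 0)"
        by (intro sum.cong) auto
      then have "mmul n A B i j = A i i * B i j"
        using True less.prems by (simp add: mmul_def)
      then show ?thesis using B(2) A0[OF True] less.prems by (auto simp: idm_def)
    next
      case False
      then show ?thesis using B(1) by (auto simp: GLn_def mats_def)
    qed
  qed
  then have "B \<in> Bup n" using B(1) by (simp add: Bup_def)
  then show thesis using B(2,3) by (rule that)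
qed

text \<open>The matrix whose determinant is the numerator of Cramer's rule for
  \<open>A x = e\<close>, with \<open>e\<close> the first coordinate vector. That numerator is
  polynomial in \<open>A\<close>, hence meaningful on a closure.\<close>

definition replace_e0 :: "nat \<Rightarrow> cmat \<Rightarrow> cmat" where
  "replace_e0 k A = (\<lambda>i j. if j = k then (if i = 0 then 1 else 0) else A i j)"

lemma mdet_replace_e0:
  assumes k: "k < n" and x: "\<And>i. i < n \<Longrightarrow> (\<Sum>k<n. A i k * x k) = (if i = 0 then 1 else 0)"
  shows "mdet n (replace_e0 k A) = x k * mdet n A"
proof -
  let ?A = "Matrix.mat n n (\<lambda>(i, j). A i j)"
  let ?x = "Matrix.vec n x"
  have "Matrix.mat n n (\<lambda>(i, j). replace_e0 k A i j) = replace_col ?A (?A *\<^sub>v ?x) k"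
    using x by (intro eq_matI)
      (auto simp: replace_col_def replace_e0_def scalar_prod_def lessThan_atLeast0)
  then show ?thesis
    unfolding mdet_eq_det using cramer_lemma_mat[of ?A n ?x k] k by simp
qed

subsection \<open>Inserting and deleting a row and a column\<close>

text \<open>The increasing injection that omits the value \<open>r\<close>; \<open>unskip r\<close>
  is its left inverse, whose value at \<open>r\<close> is never read by \<open>ins\<close>.\<close>

definition skip :: "nat \<Rightarrow> nat \<Rightarrow> nat" where
  "skip r i = (if i < r then i else Suc i)"

definition unskip :: "nat \<Rightarrow> nat \<Rightarrow> nat" where
  "unskip r i = (if i < r then i else i - 1)"

definition del :: "nat \<Rightarrow> nat \<Rightarrow> cmat \<Rightarrow> cmat" where
  "del r c A = (\<lambda>i j. A (skip r i) (skip c j))"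

definition ins :: "nat \<Rightarrow> nat \<Rightarrow> cmat \<Rightarrow> cmat" where
  "ins r c A = (\<lambda>i j. if i = r then (if j = c then 1 else 0)
     else if j = c then 0 else A (unskip r i) (unskip c j))"

lemma skip_neq [simp]: "skip r i \<noteq> r" "r \<noteq> skip r i"
  by (auto simp: skip_def)

lemma skip_0 [simp]: "skip 0 i = Suc i"
  by (simp add: skip_def)

lemma unskip_skip [simp]: "unskip r (skip r i) = i"
  by (auto simp: skip_def unskip_def)

lemma skip_inject [simp]: "skip r i = skip r j \<longleftrightarrow> i = j"
  by (auto simp: skip_def)

lemma skip_less_iff [simp]: "skip r i < skip r j \<longleftrightarrow> i < j"
  by (auto simp: skip_def)

lemma skip_less_Suc: "r \<le> n \<Longrightarrow> skip r i < Suc n \<longleftrightarrow> i < n"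
  by (auto simp: skip_def)

lemma skip_cases:
  assumes "i < Suc n" "r \<le> n"
  obtains "i = r" | i' where "i' < n" "i = skip r i'"
proof (cases "i < r")
  case True
  then show thesis using that(2)[of i] assms by (auto simp: skip_def)
next
  case False
  then show thesis using that(1) that(2)[of "i - 1"] assms by (cases "i = r") (auto simp: skip_def)
qed

lemma sum_skip:
  fixes f :: "nat \<Rightarrow> complex"
  assumes "r \<le> n"
  shows "(\<Sum>k<Suc n. f k) = f r + (\<Sum>k<n. f (skip r k))"
proof -
  have "{..<Suc n} = insert r (skip r ` {..<n})"
    using assms by (auto simp: skip_less_Suc elim!: skip_cases[OF _ assms])
  then have "(\<Sum>k<Suc n. f k) = f r + sum f (skip r ` {..<n})"
    by (simp del: lessThan_Suc) (subst sum.insert, auto)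
  also have "sum f (skip r ` {..<n}) = (\<Sum>k<n. f (skip r k))"
    by (subst sum.reindex) (auto intro: inj_onI)
  finally show ?thesis .
qed

lemma ins_simps [simp]:
  "ins r c A r c = 1"
  "ins r c A r (skip c j) = 0"
  "ins r c A (skip r i) c = 0"
  "ins r c A (skip r i) (skip c j) = A i j"
  by (auto simp: ins_def)

lemma ins_0_simps [simp]:
  "ins 0 c A (Suc i) c = 0"
  "ins 0 c A (Suc i) (skip c j) = A i j"
  by (simp_all only: skip_0[symmetric] ins_simps)

lemma del_ins [simp]: "del r c (ins r c A) = A"
  by (simp add: del_def)

lemma ins_mats: "r \<le> n \<Longrightarrow> c \<le> n \<Longrightarrow> A \<in> mats n \<Longrightarrow> ins r c A \<in> mats (Suc n)"
  by (auto simp: mats_def ins_def unskip_def)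

lemma del_mats: "r \<le> n \<Longrightarrow> c \<le> n \<Longrightarrow> A \<in> mats (Suc n) \<Longrightarrow> del r c A \<in> mats n"
  by (auto simp: mats_def del_def skip_def)

lemma ins_del:
  assumes "A \<in> mats (Suc n)" "r \<le> n" "c \<le> n" "A r c = 1"
    and "\<And>j. j < Suc n \<Longrightarrow> j \<noteq> c \<Longrightarrow> A r j = 0" "\<And>i. i < Suc n \<Longrightarrow> i \<noteq> r \<Longrightarrow> A i c = 0"
  shows "ins r c (del r c A) = A"
proof (rule mats_eqI[of _ "Suc n"])
  show "ins r c (del r c A) \<in> mats (Suc n)"
    using assms by (intro ins_mats del_mats)
  fix i j assume "i < Suc n" "j < Suc n"
  then show "ins r c (del r c A) i j = A i j"
    using assms by (elim skip_cases[OF _ assms(2)] skip_cases[OF _ assms(3)])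
      (auto simp: del_def skip_less_Suc)
qed fact

lemma mmul_skip:
  assumes "i < Suc n" "j < Suc n" "l \<le> n"
  shows "mmul (Suc n) A B i j = A i l * B l j + (\<Sum>k<n. A i (skip l k) * B (skip l k) j)"
  using assms sum_skip[of l n "\<lambda>k. A i k * B k j"]
  by (simp add: mmul_def del: sum.lessThan_Suc)

text \<open>The two pivots share the middle index \<open>l\<close>, so they only meet each other.
  With pivots \<open>(0, 0)\<close>, \<open>(0, c)\<close>, \<open>(c, c)\<close> this inserts a row
  and a column into a product \<open>p V b\<close> while its outer factors stay triangular.\<close>

lemma mmul_ins:
  assumes "r \<le> n" "l \<le> n" "c \<le> n"
  shows "mmul (Suc n) (ins r l A) (ins l c B) = ins r c (mmul n A B)"
proof (rule mats_eqI[of _ "Suc n"])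
  show "ins r c (mmul n A B) \<in> mats (Suc n)"
    using assms by (intro ins_mats) auto
  fix i j assume ij: "i < Suc n" "j < Suc n"
  show "mmul (Suc n) (ins r l A) (ins l c B) i j = ins r c (mmul n A B) i j"
    unfolding mmul_skip[OF ij assms(2)]
    using ij by (elim skip_cases[OF _ assms(1)] skip_cases[OF _ assms(3)])
      (auto simp: mmul_def)
qed simp

lemma mdet_ins:
  assumes "c \<le> n"
  shows "mdet (Suc n) (ins 0 c A) = (-1) ^ c * mdet n A"
proof -
  let ?M = "Matrix.mat (Suc n) (Suc n) (\<lambda>(i, j). ins 0 c A i j)"
  have "Determinant.det ?M = (\<Sum>j<Suc n. ?M $$ (0, j) * cofactor ?M 0 j)"
    by (rule laplace_expansion_row) auto
  also have "\<dots> = (\<Sum>j<Suc n. if j = c then cofactor ?M 0 c else 0)"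
    by (intro sum.cong) (auto simp: ins_def)
  also have "\<dots> = cofactor ?M 0 c" using assms by simp
  also have "mat_delete ?M 0 c = Matrix.mat n n (\<lambda>(i, j). A i j)"
    using assms by (intro eq_matI) (auto simp: mat_delete_def ins_def unskip_def)
  then have "cofactor ?M 0 c = (-1) ^ c * Determinant.det (Matrix.mat n n (\<lambda>(i, j). A i j))"
    by (simp add: cofactor_def)
  finally show ?thesis by (simp add: mdet_eq_det)
qed

lemma ins_GLn_iff:
  "c \<le> n \<Longrightarrow> A \<in> mats n \<Longrightarrow> ins 0 c A \<in> GLn (Suc n) \<longleftrightarrow> A \<in> GLn n"
  by (auto simp: GLn_def mdet_ins ins_mats)

lemma ins_Bup: "r \<le> n \<Longrightarrow> A \<in> Bup n \<Longrightarrow> ins r r A \<in> Bup (Suc n)"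
  by (auto simp: Bup_iff upper_def ins_mats) (auto simp: ins_def unskip_def split: if_splits)

lemma ins_Blow: "r \<le> n \<Longrightarrow> A \<in> Blow n \<Longrightarrow> ins r r A \<in> Blow (Suc n)"
  by (auto simp: Blow_iff ins_mats) (auto simp: ins_def unskip_def split: if_splits)

lemma ins_Torus: "r \<le> n \<Longrightarrow> A \<in> Torus n \<Longrightarrow> ins r r A \<in> Torus (Suc n)"
  by (auto simp: Torus_iff ins_mats) (auto simp: ins_def unskip_def split: if_splits)

lemma del_Bup: "r \<le> n \<Longrightarrow> A \<in> Bup (Suc n) \<Longrightarrow> del r r A \<in> Bup n"
  by (auto simp: Bup_iff upper_def del_mats) (auto simp: del_def skip_less_Suc)

lemma del_Blow: "r \<le> n \<Longrightarrow> A \<in> Blow (Suc n) \<Longrightarrow> del r r A \<in> Blow n"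
  by (auto simp: Blow_iff del_mats) (auto simp: del_def skip_less_Suc)

lemma del_Torus: "r \<le> n \<Longrightarrow> A \<in> Torus (Suc n) \<Longrightarrow> del r r A \<in> Torus n"
  by (auto simp: Torus_iff del_mats) (auto simp: del_def skip_less_Suc)

lemma pmat_mats [simp]: "pmat n w \<in> mats n"
  by (auto simp: pmat_def mats_def)

lemma eps_permutes:
  assumes "w permutes {1..n}" "1 \<le> j" "j \<le> Suc n"
  shows "eps n j w permutes {1..Suc n}"
proof (rule bij_imp_permutes)
  have w: "w x \<in> {1..n}" if "1 \<le> x" "x \<le> n" for x
    using permutes_in_image[OF assms(1), of x] that by auto
  have w0: "w x \<noteq> 0" if "1 \<le> x" "x \<le> n" for x
    using w[OF that] by auto
  have inj: "w x = w y \<longleftrightarrow> x = y" for x y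
    by (rule inj_eq[OF permutes_inj[OF assms(1)]])
  have "inj_on (eps n j w) {1..Suc n}"
  proof (rule inj_onI)
    fix x y assume xy: "x \<in> {1..Suc n}" "y \<in> {1..Suc n}" "eps n j w x = eps n j w y"
    have 1: "w x \<noteq> 0" if "x < j" by (rule w0) (use xy(1) assms that in auto)
    have 2: "w (x - 1) \<noteq> 0" if "x > j" by (rule w0) (use xy(1) assms that in auto)
    have 3: "w y \<noteq> 0" if "y < j" by (rule w0) (use xy(2) assms that in auto)
    have 4: "w (y - 1) \<noteq> 0" if "y > j" by (rule w0) (use xy(2) assms that in auto)
    show "x = y"
    proof (cases x j rule: linorder_cases; cases y j rule: linorder_cases)
    qed (use xy 1 2 3 4 in \<open>simp_all add: eps_def inj\<close>; arith)+
  qed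
  moreover have "eps n j w ` {1..Suc n} \<subseteq> {1..Suc n}"
  proof
    fix y assume "y \<in> eps n j w ` {1..Suc n}"
    then obtain x where x: "x \<in> {1..Suc n}" "y = eps n j w x" by blast
    consider "x < j" | "x = j" | "x > j" by linarith
    then show "y \<in> {1..Suc n}"
    proof cases
      case 1 then show ?thesis using x w[of x] assms by (auto simp: eps_def)
    next
      case 2 then show ?thesis using x assms by (auto simp: eps_def)
    next
      case 3
      then have "w (x - 1) \<in> {1..n}" using x assms by (intro w) auto
      then show ?thesis using x 3 assms by (auto simp: eps_def)
    qed
  qed
  ultimately show "bij_betw (eps n j w) {1..Suc n} {1..Suc n}"
    by (simp add: bij_betw_def endo_inj_surj)
qed (auto simp: eps_def)

text \<open>Raising all values of \<open>w\<close> by one moves the rows down and frees the first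
  one; the letter index \<open>Suc c\<close> counts from 1, the column \<open>c\<close> from
  0.\<close>

lemma pmat_eps:
  assumes "w permutes {1..n}" "c \<le> n"
  shows "pmat (Suc n) (eps n (Suc c) w) = ins 0 c (pmat n w)"
proof (rule mats_eqI[of _ "Suc n"])
  \<comment> \<open>A value 0 would be raised to 1 and put a second 1 into the first row.\<close>
  have w: "w (Suc j) \<noteq> 0" if "j < n" for j
    using permutes_in_image[OF assms(1), of "Suc j"] that by auto
  fix i j assume ij: "i < Suc n" "j < Suc n"
  consider "j < c" | "j = c" | "j > c" by linarith
  then show "pmat (Suc n) (eps n (Suc c) w) i j = ins 0 c (pmat n w) i j"
  proof cases
    case 1 then show ?thesis using ij w[of j] assms(2)
      by (cases i) (auto simp: pmat_def eps_def ins_def unskip_def)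
  next
    case 2 then show ?thesis using ij assms(2)
      by (cases i) (auto simp: pmat_def eps_def ins_def unskip_def)
  next
    case 3 then show ?thesis using ij w[of "j - 1"] assms(2)
      by (cases i) (auto simp: pmat_def eps_def ins_def unskip_def)
  qed
qed (use assms in \<open>auto intro: ins_mats\<close>)

text \<open>The rows of a permutation matrix are distinct unit vectors, so its transpose is a right
  inverse.\<close>

lemma pmat_GLn:
  assumes "w permutes {1..n}"
  shows "pmat n w \<in> GLn n"
proof (rule GLnI_right_inverse[where B = "\<lambda>i j. pmat n w j i"])
  have inj: "w x = w y \<longleftrightarrow> x = y" for x y
    by (rule inj_eq[OF permutes_inj[OF assms(1)]])
  show "mmul n (pmat n w) (\<lambda>i j. pmat n w j i) = idm n"
  proof (rule mats_eqI[of _ n])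
    fix i j assume ij: "i < n" "j < n"
    have "Suc i \<in> w ` {1..n}" using permutes_image[OF assms] ij by auto
    then obtain k where k: "w k = Suc i" "1 \<le> k" "k \<le> n" by auto
    have eq: "Suc i = w (Suc l) \<longleftrightarrow> l = k - 1" for l
      using inj[of k "Suc l"] k by auto
    have "pmat n w i l * pmat n w j l =
        (if l = k - 1 then (if Suc j = w (Suc l) then 1 else 0) else 0)" if "l < n" for l
      using that ij by (auto simp: pmat_def eq)
    then have "(\<Sum>l<n. pmat n w i l * pmat n w j l) =
        (\<Sum>l<n. if l = k - 1 then (if Suc j = w (Suc l) then 1 else 0) else 0)"
      by (intro sum.cong) simp_all
    then show "mmul n (pmat n w) (\<lambda>i j. pmat n w j i) i j = idm n i j"
      using k ij by (auto simp: idm_def mmul_def)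
  qed simp_all
qed simp

subsection \<open>Limits of matrices\<close>

lemma cmat_continuousI:
  fixes f :: "'a::topological_space \<Rightarrow> cmat"
  assumes "\<And>i j. continuous_on S (\<lambda>x. f x i j)"
  shows "continuous_on S f"
  by (rule continuous_on_coordinatewise_then_product, rule continuous_on_coordinatewise_then_product, rule assms)

lemma cmat_continuous_entry:
  fixes f :: "'a::topological_space \<Rightarrow> cmat"
  assumes "continuous_on S f"
  shows "continuous_on S (\<lambda>x. f x i j)"
  by (rule continuous_on_product_then_coordinatewise, rule continuous_on_product_then_coordinatewise, rule assms)

lemma continuous_on_mmul:
  fixes f g :: "'a::topological_space \<Rightarrow> cmat"
  assumes "continuous_on S f" "continuous_on S g"
  shows "continuous_on S (\<lambda>x. mmul n (f x) (g x))"
proof (rule cmat_continuousI)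
  fix i j
  show "continuous_on S (\<lambda>x. mmul n (f x) (g x) i j)"
  proof (cases "i < n \<and> j < n")
    case True
    have "continuous_on S (\<lambda>x. \<Sum>k<n. f x i k * g x k j)"
      by (intro continuous_on_sum continuous_on_mult cmat_continuous_entry assms)
    then show ?thesis using True by (simp add: mmul_def)
  next
    case False
    then have "(\<lambda>x. mmul n (f x) (g x) i j) = (\<lambda>x. 0)" by (auto simp: mmul_def)
    then show ?thesis by (simp only: continuous_on_const)
  qed
qed

lemmas continuous_on_entry = cmat_continuous_entry[OF continuous_on_id]

lemma continuous_on_ins:
  fixes f :: "'a::topological_space \<Rightarrow> cmat"
  assumes "continuous_on S f"
  shows "continuous_on S (\<lambda>x. ins r c (f x))"
proof (rule cmat_continuousI)
  fix i j
  show "continuous_on S (\<lambda>x. ins r c (f x) i j)"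
  proof (cases "i = r \<or> j = c")
    case True
    then have "(\<lambda>x. ins r c (f x) i j) = (\<lambda>x. ins r c (idm 0) i j)" by (auto simp: ins_def)
    then show ?thesis by (simp only: continuous_on_const)
  next
    case False
    then have "(\<lambda>x. ins r c (f x) i j) = (\<lambda>x. f x (unskip r i) (unskip c j))"
      by (auto simp: ins_def)
    then show ?thesis by (simp only: cmat_continuous_entry[OF assms])
  qed
qed

lemma continuous_on_del:
  fixes f :: "'a::topological_space \<Rightarrow> cmat"
  assumes "continuous_on S f"
  shows "continuous_on S (\<lambda>x. del r c (f x))"
  unfolding del_def by (rule cmat_continuousI, rule cmat_continuous_entry, rule assms)

lemma continuous_on_mmul_right: "continuous_on S (\<lambda>A. mmul n A B)"
  by (rule continuous_on_mmul) (rule continuous_on_id continuous_on_const)+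

lemma continuous_on_mmul_left: "continuous_on S (mmul n A)"
  by (rule continuous_on_mmul) (rule continuous_on_id continuous_on_const)+

text \<open>The form of most closure arguments below: a continuous map need only be controlled on
  the cell, and even there only up to closure.\<close>

lemma closure_map:
  fixes f :: "cmat \<Rightarrow> cmat"
  assumes "continuous_on UNIV f" "A \<in> closure S" "\<And>X. X \<in> S \<Longrightarrow> f X \<in> closure U"
  shows "f A \<in> closure U"
proof -
  have "f ` closure S \<subseteq> closure U"
    using assms by (intro image_closure_subset) (auto intro: continuous_on_subset)
  then show ?thesis using assms(2) by blast
qed

text \<open>Extends a statement from generic to special parameters; the filter \<open>at a\<close>
  leaves out \<open>a\<close> itself, where the generic argument may break down.\<close>

lemma limit_in_closed:
  fixes f :: "complex \<Rightarrow> cmat"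
  assumes "continuous_on UNIV f" "closed K" "\<forall>\<^sub>F z in at a. f z \<in> K"
  shows "f a \<in> K"
proof (rule Lim_in_closed_set[OF assms(2,3)])
  show "(f \<longlongrightarrow> f a) (at a)"
    using assms(1) by (simp add: continuous_on_def)
qed simp

text \<open>Zero diagonal entries are moved to \<open>z\<close>, and \<open>z\<close> tends to 0.
  This admits the singular triangular factors that arise when rows and columns are removed or a
  block degenerates.\<close>

lemma upper_closure_Bup:
  assumes "M \<in> upper n"
  shows "M \<in> closure (Bup n)"
proof -
  define f where "f z = (\<lambda>i j. if i = j \<and> i < n \<and> M i i = 0 then z else M i j)" for z :: complex
  have "f 0 \<in> closure (Bup n)"
  proof (rule limit_in_closed)
    show "continuous_on UNIV f"
    proof (rule cmat_continuousI)
      fix i j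
      show "continuous_on UNIV (\<lambda>z. f z i j)"
      proof (cases "i = j \<and> i < n \<and> M i i = 0")
        case True
        then have "(\<lambda>z. f z i j) = (\<lambda>z. z)" by (auto simp: f_def)
        then show ?thesis by (simp only: continuous_on_id)
      next
        case False
        then have "(\<lambda>z. f z i j) = (\<lambda>z. M i j)" unfolding f_def by (intro ext if_not_P)
        then show ?thesis by (simp only: continuous_on_const)
      qed
    qed
    have "f z \<in> Bup n" if "z \<noteq> 0" for z
      using assms that by (auto simp: f_def Bup_iff upper_def mats_def)
    then have "\<forall>z. z \<noteq> 0 \<longrightarrow> f z \<in> closure (Bup n)"
      using closure_subset by blast
    then show "\<forall>\<^sub>F z in at 0. f z \<in> closure (Bup n)"
      by (simp add: eventually_at_filter)
  qed simp
  moreover have "f 0 = M" unfolding f_def by (intro ext) auto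
  ultimately show ?thesis by simp
qed

lemma setmul3_closure_upper:
  assumes "p \<in> P" "M \<in> upper n"
  shows "mmul n (mmul n p w) M \<in> closure (setmul3 n P w (Bup n))"
proof (rule closure_map[OF _ upper_closure_Bup[OF assms(2)]])
  fix b assume "b \<in> Bup n"
  then have "mmul n (mmul n p w) b \<in> setmul3 n P w (Bup n)"
    using assms(1) by (auto simp: setmul3_def)
  then show "mmul n (mmul n p w) b \<in> closure (setmul3 n P w (Bup n))"
    using closure_subset by blast
qed (intro continuous_on_mmul_right continuous_on_mmul_left)

lemma setmul3_closure_mmul:
  assumes "A \<in> closure (setmul3 n P w (Bup n))" "b \<in> Bup n"
  shows "mmul n A b \<in> closure (setmul3 n P w (Bup n))"
proof (rule closure_map[OF _ assms(1)])
  fix X assume "X \<in> setmul3 n P w (Bup n)"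
  then obtain p q where "p \<in> P" "q \<in> Bup n" "X = mmul n (mmul n p w) q"
    by (auto simp: setmul3_def)
  then have "mmul n X b = mmul n (mmul n p w) (mmul n q b)" "mmul n q b \<in> Bup n"
    using assms(2) by (simp_all add: mmul_assoc Bup_mmul)
  then have "mmul n X b \<in> setmul3 n P w (Bup n)"
    using \<open>p \<in> P\<close> unfolding setmul3_def by blast
  then show "mmul n X b \<in> closure (setmul3 n P w (Bup n))"
    using closure_subset by blast
qed (intro continuous_on_mmul_right continuous_on_mmul_left)

subsection \<open>Schubert varieties under insertion and deletion\<close>

text \<open>The minimal parabolic for the columns \<open>j\<close> and \<open>j + 1\<close> together
  with its singular limits; invertibility is added separately where it matters.\<close>

definition pshape :: "nat \<Rightarrow> nat \<Rightarrow> cmat set" where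
  "pshape n j = {q \<in> mats n. \<forall>i k. k < i \<longrightarrow> \<not> (i = Suc j \<and> k = j) \<longrightarrow> q i k = 0}"

lemma pshape_mmul:
  assumes "p \<in> pshape n j" "q \<in> pshape n j"
  shows "mmul n p q \<in> pshape n j"
proof -
  \<comment> \<open>If \<open>p i s\<close> can be nonzero, then \<open>s\<close> is at least
    \<open>i\<close> or \<open>(i, s) = (j + 1, j)\<close>; either way \<open>(s, k)\<close> stays
    strictly below the diagonal and off the exceptional place.\<close>
  have "p i s * q s k = 0" if *: "k < i" "\<not> (i = Suc j \<and> k = j)" for i s k
  proof (cases "s < i \<and> \<not> (i = Suc j \<and> s = j)")
    case True
    then show ?thesis using assms(1) by (simp add: pshape_def)
  next
    case False
    then consider "i \<le> s" | "i = Suc j" "s = j" by fastforce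
    then have "k < s \<and> \<not> (s = Suc j \<and> k = j)"
    proof cases
      case 1
      have False if "s = Suc j" "k = j"
      proof -
        have "i = Suc j" using 1 * that by simp
        then show False using * that by simp
      qed
      moreover have "k < s" using 1 * by simp
      ultimately show ?thesis by blast
    next
      case 2
      then have "k \<noteq> j" "k \<le> j" using * by auto
      then show ?thesis using 2 by simp
    qed
    then have "q s k = 0" using assms(2) unfolding pshape_def by blast
    then show ?thesis by simp
  qed
  then have "mmul n p q i k = 0" if "k < i" "\<not> (i = Suc j \<and> k = j)" for i k
    using that unfolding mmul_def by (auto intro!: sum.neutral)
  then show ?thesis unfolding pshape_def by simp
qed

lemma Bup_pshape: "b \<in> Bup n \<Longrightarrow> b \<in> pshape n j"
  by (auto simp: Bup_iff upper_def pshape_def)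

lemma upper_pshape_iff:
  "q \<in> upper n \<longleftrightarrow> q \<in> pshape n j \<and> q (Suc j) j = 0"
  by (auto simp: upper_def pshape_def)

text \<open>Column \<open>j\<close> holds the only entry allowed below the diagonal. Removing it
  together with row \<open>j\<close> serves the letter \<open>R\<close>, with row
  \<open>j + 1\<close> the letter \<open>T\<close>.\<close>

lemma del_pshape_upper:
  assumes "q \<in> pshape (Suc n) j" "i = j \<or> i = Suc j" "i \<le> n"
  shows "del i j q \<in> upper n"
proof -
  have "del i j q \<in> mats n" using assms by (intro del_mats) (auto simp: pshape_def)
  moreover have "skip j k' < skip i i'" if "k' < i'" for k' i'
    using that assms(2) by (auto simp: skip_def)
  moreover have "skip j k' \<noteq> j" for k' by simp
  ultimately show ?thesis using assms(1) by (auto simp: upper_def pshape_def del_def)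
qed

text \<open>The Schur complement at the pivot \<open>(r, c)\<close>, cleared of denominators.\<close>
definition schur :: "nat \<Rightarrow> nat \<Rightarrow> cmat \<Rightarrow> cmat" where
  "schur r c A = (\<lambda>i k. A r c * A (skip r i) (skip c k) - A r (skip c k) * A (skip r i) c)"

lemma schur_ins [simp]: "schur r c (ins r c A) = A"
  by (simp add: schur_def)

lemma schur_mats: "r \<le> n \<Longrightarrow> c \<le> n \<Longrightarrow> A \<in> mats (Suc n) \<Longrightarrow> schur r c A \<in> mats n"
  by (auto simp: mats_def schur_def skip_def)

lemma schur_pshape_upper:
  assumes "q \<in> pshape (Suc n) j" "j \<le> n"
  shows "schur j j q \<in> upper n"
proof -
  have q: "q i k = 0" if "k < i" "\<not> (i = Suc j \<and> k = j)" for i k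
    using assms that by (auto simp: pshape_def)
  have "schur j j q i k = 0" if "k < i" for i k
  proof -
    have "q (skip j i) (skip j k) = 0" using that by (intro q) auto
    \<comment> \<open>A nonzero entry of column \<open>j\<close> lies in a row at most
      \<open>j + 1\<close>; this forces \<open>skip j k < j\<close>, where row \<open>j\<close>
      vanishes.\<close>
    moreover have "q j (skip j k) * q (skip j i) j = 0"
    proof (cases "q (skip j i) j = 0")
      case False
      then have "skip j i \<le> Suc j" using q[of j "skip j i"] by fastforce
      then have "skip j k < j" using that by (auto simp: skip_def split: if_splits)
      then show ?thesis using q[of "skip j k" j] by simp
    qed simp
    ultimately show ?thesis by (simp add: schur_def)
  qed
  moreover have "schur j j q \<in> mats n"
    using assms by (intro schur_mats) (auto simp: pshape_def)
  ultimately show ?thesis by (simp add: upper_def)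
qed

lemma continuous_on_schur: "continuous_on S (schur r c)"
proof (rule cmat_continuousI)
  fix i j
  show "continuous_on S (\<lambda>A. schur r c A i j)"
    unfolding schur_def by (rule continuous_on_diff; rule continuous_on_mult; rule continuous_on_entry)
qed

lemma mmul_Suc_row:
  assumes "i < n" "k < Suc n" "b (Suc i) 0 = 0"
  shows "mmul (Suc n) b M (Suc i) k = (\<Sum>s<n. b (Suc i) (Suc s) * M (Suc s) k)"
  using mmul_skip[of "Suc i" n k 0 b M] assms by simp

text \<open>Below its first row, an upper triangular \<open>b\<close> never uses the first row of
  \<open>M\<close>. A lower triangular factor may, which is why the lower cell is treated by
  \<open>schur\<close> instead.\<close>

lemma del_mmul_upper:
  assumes "b \<in> upper (Suc n)" "j \<le> n"
  shows "del 0 j (mmul (Suc n) b M) = mmul n (del 0 0 b) (del 0 j M)"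
proof (rule mats_eqI[of _ n])
  fix i k assume ik: "i < n" "k < n"
  have "b (Suc i) 0 = 0" using assms(1) by (auto simp: upper_def)
  then show "del 0 j (mmul (Suc n) b M) i k = mmul n (del 0 0 b) (del 0 j M) i k"
    using ik assms mmul_Suc_row[of i n "skip j k" b M]
    by (simp add: del_def skip_less_Suc) (simp add: mmul_def)
qed (use assms in \<open>auto intro: del_mats\<close>)

lemma ins_mmul_Suc_row:
  assumes "i < n" "k < Suc n" "c \<le> n"
  shows "mmul (Suc n) (ins 0 c V) q (Suc i) k = (\<Sum>t<n. V i t * q (skip c t) k)"
  using mmul_skip[of "Suc i" n k c "ins 0 c V" q] assms by simp

lemma ins_mmul_row_0:
  assumes "k < Suc n" "c \<le> n"
  shows "mmul (Suc n) (ins 0 c V) q 0 k = q c k"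
  using mmul_skip[of 0 n k c "ins 0 c V" q] assms by simp

lemma del_ins_mmul:
  assumes "c \<le> n" "j \<le> n"
  shows "del 0 j (mmul (Suc n) (ins 0 c V) q) = mmul n V (del c j q)"
proof (rule mats_eqI[of _ n])
  fix i k assume ik: "i < n" "k < n"
  show "del 0 j (mmul (Suc n) (ins 0 c V) q) i k = mmul n V (del c j q) i k"
    using ik assms ins_mmul_Suc_row[of i n "skip j k" c V q]
    by (simp add: del_def skip_less_Suc) (simp add: mmul_def)
qed (use assms in \<open>auto intro: del_mats\<close>)

text \<open>The first row of the product is row \<open>j\<close> of \<open>q\<close>, and the minors
  are linear in the remaining rows, which \<open>V\<close> combines.\<close>

lemma schur_ins_mmul:
  assumes "j \<le> n"
  shows "schur 0 j (mmul (Suc n) (ins 0 j V) q) = mmul n V (schur j j q)"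
proof (rule mats_eqI[of _ n])
  fix i k assume ik: "i < n" "k < n"
  then have k: "skip j k < Suc n" using assms by (simp add: skip_less_Suc)
  have "schur 0 j (mmul (Suc n) (ins 0 j V) q) i k =
      q j j * (\<Sum>t<n. V i t * q (skip j t) (skip j k)) - q j (skip j k) * (\<Sum>t<n. V i t * q (skip j t) j)"
    using ik assms k by (simp add: schur_def ins_mmul_Suc_row ins_mmul_row_0)
  also have "\<dots> = mmul n V (schur j j q) i k"
    using ik by (simp add: mmul_def schur_def sum_distrib_left sum_subtractf[symmetric] algebra_simps)
  finally show "schur 0 j (mmul (Suc n) (ins 0 j V) q) i k = mmul n V (schur j j q) i k" .
qed (use assms in \<open>auto intro: schur_mats\<close>)

text \<open>A lower triangular factor scales the first row and adds multiples of it to the others.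
  The minors with the first row are blind to the second operation, and the scaling survives as
  \<open>b 0 0\<close>.\<close>

lemma schur_mmul_lower:
  assumes b: "\<And>i j. i < j \<Longrightarrow> b i j = 0" and "j \<le> n"
  shows "schur 0 j (mmul (Suc n) b M) = mmul n (\<lambda>i k. b 0 0 * del 0 0 b i k) (schur 0 j M)"
proof (rule mats_eqI[of _ n])
  fix i k assume ik: "i < n" "k < n"
  then have k: "skip j k < Suc n" using assms by (simp add: skip_less_Suc)
  have 0: "mmul (Suc n) b M 0 l = b 0 0 * M 0 l" if "l < Suc n" for l
    using mmul_skip[of 0 n l 0 b M] that b by simp
  have 1: "mmul (Suc n) b M (Suc i) l =
      b (Suc i) 0 * M 0 l + (\<Sum>s<n. b (Suc i) (Suc s) * M (Suc s) l)" if "l < Suc n" for l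
    using mmul_skip[of "Suc i" n l 0 b M] that ik by simp
  have "schur 0 j (mmul (Suc n) b M) i k =
      b 0 0 * (M 0 j * (\<Sum>s<n. b (Suc i) (Suc s) * M (Suc s) (skip j k)) -
        M 0 (skip j k) * (\<Sum>s<n. b (Suc i) (Suc s) * M (Suc s) j))"
    using ik assms(2) k by (simp add: schur_def 0 1 algebra_simps)
  also have "\<dots> = mmul n (\<lambda>i k. b 0 0 * del 0 0 b i k) (schur 0 j M) i k"
    using ik by (simp add: mmul_def schur_def del_def sum_distrib_left sum_subtractf[symmetric] algebra_simps)
  finally show "schur 0 j (mmul (Suc n) b M) i k =
      mmul n (\<lambda>i k. b 0 0 * del 0 0 b i k) (schur 0 j M) i k" .
qed (use assms in \<open>auto intro: schur_mats\<close>)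

text \<open>\<open>V\<close> is inserted at column \<open>j\<close> for an \<open>R\<close> and at
  \<open>j + 1\<close> for a \<open>T\<close>, but in both cases column \<open>j\<close> of
  \<open>A q\<close> is removed, so one map handles both letters. The factor \<open>q\<close> may
  mix the columns \<open>j\<close> and \<open>j + 1\<close>.\<close>

lemma del_closure_up:
  assumes A: "A \<in> closure (setmul3 (Suc n) (Bup (Suc n)) (ins 0 i V) (Bup (Suc n)))"
    and q: "q \<in> pshape (Suc n) j" and i: "i = j \<or> i = Suc j" "i \<le> n"
  shows "del 0 j (mmul (Suc n) A q) \<in> closure (setmul3 n (Bup n) V (Bup n))"
proof (rule closure_map[OF _ A])
  show "continuous_on UNIV (\<lambda>A. del 0 j (mmul (Suc n) A q))"
    by (rule continuous_on_del, rule continuous_on_mmul_right)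
  fix X assume "X \<in> setmul3 (Suc n) (Bup (Suc n)) (ins 0 i V) (Bup (Suc n))"
  then obtain b c where bc: "b \<in> Bup (Suc n)" "c \<in> Bup (Suc n)"
    and X: "X = mmul (Suc n) (mmul (Suc n) b (ins 0 i V)) c"
    by (auto simp: setmul3_def)
  have j: "j \<le> n" using i by auto
  let ?q = "mmul (Suc n) c q"
  have "?q \<in> pshape (Suc n) j" by (intro pshape_mmul q Bup_pshape bc)
  then have up: "del i j ?q \<in> upper n" using i by (rule del_pshape_upper)
  have "b \<in> upper (Suc n)" using bc by (simp add: Bup_iff)
  then have "del 0 j (mmul (Suc n) X q) = mmul n (mmul n (del 0 0 b) V) (del i j ?q)"
    unfolding X mmul_assoc by (simp only: del_mmul_upper del_ins_mmul i j)
  then show "del 0 j (mmul (Suc n) X q) \<in> closure (setmul3 n (Bup n) V (Bup n))"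
    using setmul3_closure_upper[OF del_Bup[of 0 n b] up] bc by simp
qed

text \<open>The lower permutation is inserted at \<open>j\<close> for both letters, so here the
  pivot never moves.\<close>

lemma schur_closure_low:
  assumes A: "A \<in> closure (setmul3 (Suc n) (Blow (Suc n)) (ins 0 j V) (Bup (Suc n)))"
    and q: "q \<in> pshape (Suc n) j" and j: "j \<le> n"
  shows "schur 0 j (mmul (Suc n) A q) \<in> closure (setmul3 n (Blow n) V (Bup n))"
proof (rule closure_map[OF _ A])
  show "continuous_on UNIV (\<lambda>A. schur 0 j (mmul (Suc n) A q))"
    by (rule continuous_on_compose2[OF continuous_on_schur continuous_on_mmul_right subset_UNIV])
  fix X assume "X \<in> setmul3 (Suc n) (Blow (Suc n)) (ins 0 j V) (Bup (Suc n))"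
  then obtain b c where bc: "b \<in> Blow (Suc n)" "c \<in> Bup (Suc n)"
    and X: "X = mmul (Suc n) (mmul (Suc n) b (ins 0 j V)) c"
    by (auto simp: setmul3_def)
  let ?q = "mmul (Suc n) c q" and ?b = "\<lambda>i k. b 0 0 * del 0 0 b i k"
  have "?q \<in> pshape (Suc n) j" by (intro pshape_mmul q Bup_pshape bc)
  then have up: "schur j j ?q \<in> upper n" using j by (rule schur_pshape_upper)
  have b: "?b \<in> Blow n"
    using del_Blow[of 0 n b] bc by (auto simp: Blow_iff mats_def)
  have "schur 0 j (mmul (Suc n) X q) = mmul n (mmul n ?b V) (schur j j ?q)"
    unfolding X mmul_assoc
    using bc by (subst schur_mmul_lower) (auto simp: Blow_iff j schur_ins_mmul)
  then show "schur 0 j (mmul (Suc n) X q) \<in> closure (setmul3 n (Blow n) V (Bup n))"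
    using setmul3_closure_upper[OF b up] by simp
qed

section \<open>The two-by-two block acting on adjacent columns\<close>

text \<open>The block is read by columns: (\<alpha>, \<beta>) is the first and (\<gamma>, \<delta>)
  the second, so \<alpha>:\<beta> is the point on the projective line.\<close>

definition blk :: "nat \<Rightarrow> nat \<Rightarrow> complex \<Rightarrow> complex \<Rightarrow> complex \<Rightarrow> complex \<Rightarrow> cmat" where
  "blk n j \<alpha> \<beta> \<gamma> \<delta> = (\<lambda>i k.
     if n \<le> i \<or> n \<le> k then 0
     else if k = j then (if i = j then \<alpha> else if i = Suc j then \<beta> else 0)
     else if k = Suc j then (if i = j then \<gamma> else if i = Suc j then \<delta> else 0)
     else if i = k then 1 else 0)"

lemma blk_mats [simp]: "blk n j \<alpha> \<beta> \<gamma> \<delta> \<in> mats n"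
  by (auto simp: mats_def blk_def)

lemma mmul_blk:
  assumes "i < n" "k < n" "Suc j < n"
  shows "mmul n M (blk n j \<alpha> \<beta> \<gamma> \<delta>) i k =
    (if k = j then \<alpha> * M i j + \<beta> * M i (Suc j)
     else if k = Suc j then \<gamma> * M i j + \<delta> * M i (Suc j) else M i k)"
proof -
  let ?B = "blk n j \<alpha> \<beta> \<gamma> \<delta>"
  have two: "(\<Sum>l<n. M i l * (if l = j then x else if l = Suc j then y else 0)) =
      x * M i j + y * M i (Suc j)" for x y
  proof -
    have "(\<Sum>l<n. M i l * (if l = j then x else if l = Suc j then y else 0)) =
        (\<Sum>l<n. (if l = j then x * M i j else 0) + (if l = Suc j then y * M i (Suc j) else 0))"
      by (intro sum.cong) auto
    then show ?thesis using assms by (simp add: sum.distrib)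
  qed
  have m: "mmul n M ?B i k = (\<Sum>l<n. M i l * ?B l k)" using assms by (simp add: mmul_def)
  consider "k = j" | "k = Suc j" | "k \<noteq> j" "k \<noteq> Suc j" by blast
  then show ?thesis
  proof cases
    case 1
    then have "(\<Sum>l<n. M i l * ?B l k) = (\<Sum>l<n. M i l * (if l = j then \<alpha> else if l = Suc j then \<beta> else 0))"
      using assms by (intro sum.cong) (auto simp: blk_def)
    then show ?thesis unfolding m two using 1 by simp
  next
    case 2
    then have "(\<Sum>l<n. M i l * ?B l k) = (\<Sum>l<n. M i l * (if l = j then \<gamma> else if l = Suc j then \<delta> else 0))"
      using assms by (intro sum.cong) (auto simp: blk_def)
    then show ?thesis unfolding m two using 2 by simp
  next
    case 3
    then have "(\<Sum>l<n. M i l * ?B l k) = (\<Sum>l<n. if l = k then M i k else 0)"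
      using assms by (intro sum.cong) (auto simp: blk_def)
    then show ?thesis unfolding m using 3 assms by simp
  qed
qed

lemma blk_pshape: "blk n j \<alpha> \<beta> \<gamma> \<delta> \<in> pshape n j"
  by (auto simp: pshape_def) (auto simp: blk_def)

lemma blk_inverse:
  assumes "\<alpha> * \<delta> - \<beta> * \<gamma> \<noteq> 0" "Suc j < n"
  obtains a b c d where "a * d - b * c \<noteq> 0"
    "mmul n (blk n j \<alpha> \<beta> \<gamma> \<delta>) (blk n j a b c d) = idm n"
    "mmul n (blk n j a b c d) (blk n j \<alpha> \<beta> \<gamma> \<delta>) = idm n"
proof -
  define D where "D = \<alpha> * \<delta> - \<beta> * \<gamma>"
  have D: "D \<noteq> 0" using assms(1) by (simp add: D_def)
  \<comment> \<open>The adjugate over the determinant, again listed by columns.\<close>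
  define a b c d where "a = \<delta> / D" and "b = - \<beta> / D" and "c = - \<gamma> / D" and "d = \<alpha> / D"
  have e: "a * \<alpha> + b * \<gamma> = 1" "a * \<beta> + b * \<delta> = 0" "c * \<alpha> + d * \<gamma> = 0" "c * \<beta> + d * \<delta> = 1"
    "\<alpha> * a + \<beta> * c = 1" "\<alpha> * b + \<beta> * d = 0" "\<gamma> * a + \<delta> * c = 0" "\<gamma> * b + \<delta> * d = 1"
    using D by (simp_all add: a_def b_def c_def d_def field_simps) (simp_all add: D_def algebra_simps)
  have 1: "mmul n (blk n j \<alpha> \<beta> \<gamma> \<delta>) (blk n j a b c d) = idm n"
  proof (rule mats_eqI[of _ n])
    fix i k assume ik: "i < n" "k < n"
    show "mmul n (blk n j \<alpha> \<beta> \<gamma> \<delta>) (blk n j a b c d) i k = idm n i k"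
      unfolding mmul_blk[OF ik assms(2)] using ik assms(2)
      by (auto simp: blk_def idm_def e)
  qed simp_all
  have 2: "mmul n (blk n j a b c d) (blk n j \<alpha> \<beta> \<gamma> \<delta>) = idm n"
  proof (rule mats_eqI[of _ n])
    fix i k assume ik: "i < n" "k < n"
    show "mmul n (blk n j a b c d) (blk n j \<alpha> \<beta> \<gamma> \<delta>) i k = idm n i k"
      unfolding mmul_blk[OF ik assms(2)] using ik assms(2)
      by (auto simp: blk_def idm_def e)
  qed simp_all
  have "a * d - b * c = D / (D * D)"
    by (simp add: a_def b_def c_def d_def D_def diff_divide_distrib mult.commute)
  then show thesis using D by (intro that[OF _ 1 2]) simp
qed

lemma blk_GLn:
  assumes "\<alpha> * \<delta> - \<beta> * \<gamma> \<noteq> 0" "Suc j < n"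
  shows "blk n j \<alpha> \<beta> \<gamma> \<delta> \<in> GLn n"
  using blk_inverse[OF assms] GLnI_right_inverse blk_mats by metis

lemma blk_upper: "blk n j \<alpha> 0 \<gamma> \<delta> \<in> upper n"
  using blk_pshape[of n j \<alpha> 0 \<gamma> \<delta>] by (auto simp: upper_pshape_iff[of _ n j]) (simp add: blk_def)

text \<open>The second column of the block stays fixed, since all limits below move only \<alpha>
  and \<beta>.\<close>

lemma continuous_on_blk:
  fixes f g :: "'a::topological_space \<Rightarrow> complex"
  assumes "continuous_on S f" "continuous_on S g"
  shows "continuous_on S (\<lambda>x. blk n j (f x) (g x) \<gamma> \<delta>)"
proof (rule cmat_continuousI)
  fix i l
  consider "(\<lambda>x. blk n j (f x) (g x) \<gamma> \<delta> i l) = f" | "(\<lambda>x. blk n j (f x) (g x) \<gamma> \<delta> i l) = g"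
    | "(\<lambda>x. blk n j (f x) (g x) \<gamma> \<delta> i l) = (\<lambda>x. blk n j 0 0 \<gamma> \<delta> i l)"
  proof (cases "n \<le> i \<or> n \<le> l \<or> l \<noteq> j \<or> (i \<noteq> j \<and> i \<noteq> Suc j)")
    case True then show thesis by (intro that(3) ext) (auto simp: blk_def)
  next
    case False
    show thesis
    proof (cases "i = j")
      case True then show thesis using False by (intro that(1) ext) (auto simp: blk_def)
    next
      case False': False then show thesis using False by (intro that(2) ext) (auto simp: blk_def)
    qed
  qed
  then show "continuous_on S (\<lambda>x. blk n j (f x) (g x) \<gamma> \<delta> i l)"
    by cases (simp_all only: assms continuous_on_const)
qed

section \<open>From smaller to larger Schubert closures\<close>

text \<open>\<open>P\<close> is a family indexed by the size, so that the upper and the lower cell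
  are treated at once.\<close>

lemma ins_setmul3:
  assumes "A \<in> closure (setmul3 n (P n) V (Bup n))" "c \<le> n"
    and P: "\<And>p. p \<in> P n \<Longrightarrow> ins 0 0 p \<in> P (Suc n)"
  shows "ins 0 c A \<in> closure (setmul3 (Suc n) (P (Suc n)) (ins 0 c V) (Bup (Suc n)))"
proof (rule closure_map[OF _ assms(1)])
  show "continuous_on UNIV (ins 0 c)" by (rule continuous_on_ins, rule continuous_on_id)
  fix X assume "X \<in> setmul3 n (P n) V (Bup n)"
  then obtain p b where pb: "p \<in> P n" "b \<in> Bup n" and X: "X = mmul n (mmul n p V) b"
    by (auto simp: setmul3_def)
  have "ins 0 c X = mmul (Suc n) (mmul (Suc n) (ins 0 0 p) (ins 0 c V)) (ins c c b)"
    unfolding X using assms(2) by (simp add: mmul_ins)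
  then have "ins 0 c X \<in> setmul3 (Suc n) (P (Suc n)) (ins 0 c V) (Bup (Suc n))"
    unfolding setmul3_def using P[OF pb(1)] ins_Bup[OF assms(2) pb(2)] by blast
  then show "ins 0 c X \<in> closure (setmul3 (Suc n) (P (Suc n)) (ins 0 c V) (Bup (Suc n)))"
    using closure_subset by blast
qed

text \<open>Write \<open>e\<close> for the first coordinate vector and \<open>a\<close> for column
  \<open>j\<close> of \<open>A\<close> moved down one row. With \<beta> nonzero, \<alpha>
  \<open>e\<close> + \<beta> \<open>a\<close> is a multiple of \<open>a\<close> + (\<alpha>/\<beta>)
  \<open>e\<close>, the image of \<open>a\<close> under an upper unipotent matrix; so
  \<open>e\<close> can enter the flag one step later, at column \<open>j + 1\<close>.\<close>

lemma ins_blk_up_generic: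
  assumes A: "A \<in> setmul3 n (Bup n) V (Bup n)" and V: "V \<in> GLn n"
    and j: "Suc j \<le> n" and \<beta>: "\<beta> \<noteq> 0"
  shows "mmul (Suc n) (ins 0 j A) (blk (Suc n) j \<alpha> \<beta> \<gamma> \<delta>)
    \<in> closure (setmul3 (Suc n) (Bup (Suc n)) (ins 0 (Suc j) V) (Bup (Suc n)))"
proof -
  obtain b c where bc: "b \<in> Bup n" "c \<in> Bup n" and Aeq: "A = mmul n (mmul n b V) c"
    using A by (auto simp: setmul3_def)
  have AG: "A \<in> GLn n" unfolding Aeq by (intro GLn_mmul V Bup_GLn[OF bc(1)] Bup_GLn[OF bc(2)])
  then obtain A' where A': "mmul n A' A = idm n" "A' \<in> GLn n" using GLn_inverse by metis
  \<comment> \<open>Row \<open>j\<close> of the inverse of \<open>A\<close> is 1 on column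
    \<open>j\<close> and 0 on the other columns of \<open>A\<close>; \<open>U\<close> adds
    \<alpha>/\<beta> times this functional to the first row. Invertibility of \<open>V\<close>
    enters here.\<close>
  define U where "U = (\<lambda>i k. if i = 0 \<and> 0 < k \<and> k < Suc n then \<alpha> / \<beta> * A' j (k - 1) else idm (Suc n) i k)"
  have U: "U \<in> Bup (Suc n)"
    by (auto simp: Bup_iff upper_def mats_def U_def idm_def)
  have row: "(\<Sum>s<n. A' j s * A s k) = (if k = j then 1 else 0)" if "k < n" for k
    using A'(1)[THEN fun_cong, THEN fun_cong, of j k] that j by (simp add: mmul_def idm_def)
  \<comment> \<open>Column operations back to the block: \<gamma> \<open>e\<close> + \<delta>
    \<open>a\<close> equals \<delta> (\<open>a\<close> + (\<alpha>/\<beta>) \<open>e\<close>) +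
    (\<gamma> - \<delta>\<alpha>/\<beta>) \<open>e\<close>. The last coefficient may be
    zero.\<close>
  define B where "B = blk (Suc n) j \<beta> 0 \<delta> (\<gamma> - \<delta> * \<alpha> / \<beta>)"
  have insA: "ins 0 (Suc j) A =
      mmul (Suc n) (mmul (Suc n) (ins 0 0 b) (ins 0 (Suc j) V)) (ins (Suc j) (Suc j) c)"
    using j by (simp add: Aeq mmul_ins)
  define X where "X = mmul (Suc n) U (ins 0 (Suc j) A)"
  have X0: "X 0 k = (if k = j then \<alpha> / \<beta> else if k = Suc j then 1 else 0)" if "k < Suc n" for k
  proof (rule skip_cases[OF that j])
    assume k: "k = Suc j"
    show ?thesis unfolding X_def using mmul_skip[of 0 n k 0 U "ins 0 (Suc j) A"] that
      by (simp add: k) (simp add: U_def idm_def)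
  next
    fix k' assume k: "k' < n" "k = skip (Suc j) k'"
    have "X 0 k = (\<Sum>s<n. \<alpha> / \<beta> * A' j s * A s k')"
      unfolding X_def using mmul_skip[of 0 n k 0 U "ins 0 (Suc j) A"] that
      by (simp add: k) (simp add: U_def)
    also have "\<dots> = \<alpha> / \<beta> * (\<Sum>s<n. A' j s * A s k')"
      by (simp add: sum_distrib_left mult.assoc)
    finally show ?thesis using k row[of k'] by (auto simp: skip_def split: if_splits)
  qed
  have X1: "X (Suc i) k = ins 0 (Suc j) A (Suc i) k" if "i < n" "k < Suc n" for i k
  proof -
    have "(\<Sum>s<n. U (Suc i) (Suc s) * ins 0 (Suc j) A (Suc s) k) =
        (\<Sum>s<n. if s = i then ins 0 (Suc j) A (Suc s) k else 0)"
      by (intro sum.cong) (auto simp: U_def idm_def that)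
    moreover have "X (Suc i) k = (\<Sum>s<n. U (Suc i) (Suc s) * ins 0 (Suc j) A (Suc s) k)"
      unfolding X_def using that by (intro mmul_Suc_row) (simp_all add: U_def idm_def)
    ultimately show ?thesis using that by simp
  qed
  have "mmul (Suc n) (ins 0 j A) (blk (Suc n) j \<alpha> \<beta> \<gamma> \<delta>) = mmul (Suc n) X B"
  proof (rule mats_eqI[of _ "Suc n"])
    fix i k assume ik: "i < Suc n" "k < Suc n"
    have j': "Suc j < Suc n" using j by simp
    show "mmul (Suc n) (ins 0 j A) (blk (Suc n) j \<alpha> \<beta> \<gamma> \<delta>) i k = mmul (Suc n) X B i k"
      unfolding B_def mmul_blk[OF ik j'] using ik \<beta> j
      by (cases i) (auto simp: X0 X1 ins_def unskip_def field_simps)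
  qed (simp_all add: X_def)
  also have "\<dots> = mmul (Suc n) (mmul (Suc n) (mmul (Suc n) U (ins 0 0 b)) (ins 0 (Suc j) V))
      (mmul (Suc n) (ins (Suc j) (Suc j) c) B)"
    unfolding X_def insA by (simp only: mmul_assoc)
  also have "\<dots> \<in> closure (setmul3 (Suc n) (Bup (Suc n)) (ins 0 (Suc j) V) (Bup (Suc n)))"
  proof (rule setmul3_closure_upper)
    show "mmul (Suc n) U (ins 0 0 b) \<in> Bup (Suc n)" by (intro Bup_mmul U ins_Bup bc) simp
    show "mmul (Suc n) (ins (Suc j) (Suc j) c) B \<in> upper (Suc n)"
      unfolding B_def using ins_Bup[OF j bc(2)] by (intro upper_mmul blk_upper) (simp add: Bup_iff)
  qed
  finally show ?thesis .
qed

text \<open>The mirror image, with \<open>e\<close> and \<open>a\<close> as in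
  \<open>ins_blk_up_generic\<close>: for \<alpha> nonzero, \<open>e\<close> + (\<beta>/\<alpha>)
  \<open>a\<close> is the image of \<open>e\<close> under a lower unipotent matrix, and
  \<open>e\<close> keeps its column \<open>j\<close>.\<close>

lemma ins_blk_low_generic:
  assumes A: "A \<in> setmul3 n (Blow n) V (Bup n)" and j: "Suc j \<le> n" and \<alpha>: "\<alpha> \<noteq> 0"
  shows "mmul (Suc n) (ins 0 j A) (blk (Suc n) j \<alpha> \<beta> \<gamma> \<delta>)
    \<in> closure (setmul3 (Suc n) (Blow (Suc n)) (ins 0 j V) (Bup (Suc n)))"
proof -
  obtain b c where bc: "b \<in> Blow n" "c \<in> Bup n" and Aeq: "A = mmul n (mmul n b V) c"
    using A by (auto simp: setmul3_def)
  have jn: "j \<le> n" using j by simp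
  \<comment> \<open>Only column 0 of \<open>L\<close> differs from the identity, so \<open>L\<close>
    moves \<open>e\<close> and fixes every column whose first entry is 0.\<close>
  define L where "L = (\<lambda>i k. if k = 0 \<and> 0 < i \<and> i < Suc n then \<beta> / \<alpha> * A (i - 1) j else idm (Suc n) i k)"
  have L: "L \<in> Blow (Suc n)"
    by (auto simp: Blow_iff mats_def L_def idm_def)
  define B where "B = blk (Suc n) j \<alpha> 0 \<gamma> (\<delta> - \<gamma> * \<beta> / \<alpha>)"
  have insA: "ins 0 j A = mmul (Suc n) (mmul (Suc n) (ins 0 0 b) (ins 0 j V)) (ins j j c)"
    using jn by (simp add: Aeq mmul_ins)
  define X where "X = mmul (Suc n) L (ins 0 j A)"
  have X0: "X 0 k = (if k = j then 1 else 0)" if "k < Suc n" for k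
    unfolding X_def using mmul_skip[of 0 n k 0 L "ins 0 j A"] that by (simp add: L_def idm_def ins_def)
  have X1: "X (Suc i) k = ins 0 j A (Suc i) k + (if k = j then \<beta> / \<alpha> * A i j else 0)"
    if "i < n" "k < Suc n" for i k
  proof -
    have "(\<Sum>s<n. L (Suc i) (Suc s) * ins 0 j A (Suc s) k) =
        (\<Sum>s<n. if s = i then ins 0 j A (Suc s) k else 0)"
      by (intro sum.cong) (auto simp: L_def idm_def that)
    then show ?thesis unfolding X_def using mmul_skip[of "Suc i" n k 0 L "ins 0 j A"] that
      by (simp add: L_def ins_def)
  qed
  have "mmul (Suc n) (ins 0 j A) (blk (Suc n) j \<alpha> \<beta> \<gamma> \<delta>) = mmul (Suc n) X B"
  proof (rule mats_eqI[of _ "Suc n"])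
    fix i k assume ik: "i < Suc n" "k < Suc n"
    have j': "Suc j < Suc n" using j by simp
    show "mmul (Suc n) (ins 0 j A) (blk (Suc n) j \<alpha> \<beta> \<gamma> \<delta>) i k = mmul (Suc n) X B i k"
      unfolding B_def mmul_blk[OF ik j'] using ik \<alpha> j
      by (cases i) (auto simp: X0 X1 ins_def unskip_def field_simps)
  qed (simp_all add: X_def)
  also have "\<dots> = mmul (Suc n) (mmul (Suc n) (mmul (Suc n) L (ins 0 0 b)) (ins 0 j V))
      (mmul (Suc n) (ins j j c) B)"
    unfolding X_def insA by (simp only: mmul_assoc)
  also have "\<dots> \<in> closure (setmul3 (Suc n) (Blow (Suc n)) (ins 0 j V) (Bup (Suc n)))"
  proof (rule setmul3_closure_upper)
    show "mmul (Suc n) L (ins 0 0 b) \<in> Blow (Suc n)" by (intro Blow_mmul L ins_Blow bc) simp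
    show "mmul (Suc n) (ins j j c) B \<in> upper (Suc n)"
      unfolding B_def using ins_Bup[OF jn bc(2)] by (intro upper_mmul blk_upper) (simp add: Bup_iff)
  qed
  finally show ?thesis .
qed

lemma ins_blk_up:
  assumes A: "A \<in> closure (setmul3 n (Bup n) V (Bup n))" and V: "V \<in> GLn n" and j: "Suc j \<le> n"
  shows "mmul (Suc n) (ins 0 j A) (blk (Suc n) j \<alpha> \<beta> \<gamma> \<delta>)
    \<in> closure (setmul3 (Suc n) (Bup (Suc n)) (ins 0 (Suc j) V) (Bup (Suc n)))" (is "_ \<in> ?K")
proof (rule closure_map[OF _ A])
  show "continuous_on UNIV (\<lambda>A. mmul (Suc n) (ins 0 j A) (blk (Suc n) j \<alpha> \<beta> \<gamma> \<delta>))"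
    by (rule continuous_on_mmul, rule continuous_on_ins, rule continuous_on_id, rule continuous_on_const)
  fix X assume X: "X \<in> setmul3 n (Bup n) V (Bup n)"
  show "mmul (Suc n) (ins 0 j X) (blk (Suc n) j \<alpha> \<beta> \<gamma> \<delta>) \<in> ?K"
  \<comment> \<open>Near any \<beta> the values \<open>z\<close> other than \<beta> are eventually
    nonzero, so the generic case yields \<beta> = 0 in the limit.\<close>
  proof (rule limit_in_closed[of "\<lambda>z. mmul (Suc n) (ins 0 j X) (blk (Suc n) j \<alpha> z \<gamma> \<delta>)"])
    show "continuous_on UNIV (\<lambda>z. mmul (Suc n) (ins 0 j X) (blk (Suc n) j \<alpha> z \<gamma> \<delta>))"
      by (rule continuous_on_mmul, rule continuous_on_const, rule continuous_on_blk,
          rule continuous_on_const, rule continuous_on_id)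
    have "\<forall>\<^sub>F z in at \<beta>. z \<noteq> 0"
      by (rule eventually_neq_at_within)
    then show "\<forall>\<^sub>F z in at \<beta>. mmul (Suc n) (ins 0 j X) (blk (Suc n) j \<alpha> z \<gamma> \<delta>) \<in> ?K"
      by eventually_elim (rule ins_blk_up_generic[OF X V j])
  qed simp
qed

lemma ins_blk_low:
  assumes A: "A \<in> closure (setmul3 n (Blow n) V (Bup n))" and j: "Suc j \<le> n"
  shows "mmul (Suc n) (ins 0 j A) (blk (Suc n) j \<alpha> \<beta> \<gamma> \<delta>)
    \<in> closure (setmul3 (Suc n) (Blow (Suc n)) (ins 0 j V) (Bup (Suc n)))" (is "_ \<in> ?K")
proof (rule closure_map[OF _ A])
  show "continuous_on UNIV (\<lambda>A. mmul (Suc n) (ins 0 j A) (blk (Suc n) j \<alpha> \<beta> \<gamma> \<delta>))"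
    by (rule continuous_on_mmul, rule continuous_on_ins, rule continuous_on_id, rule continuous_on_const)
  fix X assume X: "X \<in> setmul3 n (Blow n) V (Bup n)"
  show "mmul (Suc n) (ins 0 j X) (blk (Suc n) j \<alpha> \<beta> \<gamma> \<delta>) \<in> ?K"
  proof (rule limit_in_closed[of "\<lambda>z. mmul (Suc n) (ins 0 j X) (blk (Suc n) j z \<beta> \<gamma> \<delta>)"])
    show "continuous_on UNIV (\<lambda>z. mmul (Suc n) (ins 0 j X) (blk (Suc n) j z \<beta> \<gamma> \<delta>))"
      by (rule continuous_on_mmul, rule continuous_on_const, rule continuous_on_blk,
          rule continuous_on_id, rule continuous_on_const)
    have "\<forall>\<^sub>F z in at \<alpha>. z \<noteq> 0"
      by (rule eventually_neq_at_within)
    then show "\<forall>\<^sub>F z in at \<alpha>. mmul (Suc n) (ins 0 j X) (blk (Suc n) j z \<beta> \<gamma> \<delta>) \<in> ?K"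
      by eventually_elim (rule ins_blk_low_generic[OF X j])
  qed simp
qed

subsection \<open>Recursion for Richardson varieties\<close>

text \<open>A lower triangular factor on the left only scales the first row, and the first row of
  \<open>ins 0 j W\<close> times \<open>c\<close> is row \<open>j\<close> of \<open>c\<close>, zero
  left of the diagonal.\<close>

lemma schubert_low_row:
  assumes A: "A \<in> closure (setmul3 (Suc n) (Blow (Suc n)) (ins 0 j W) (Bup (Suc n)))"
    and j: "j \<le> n" "k < j"
  shows "A 0 k = 0"
proof -
  let ?K = "{A :: cmat. A 0 k = 0}"
  have "closed ?K"
    by (rule closed_Collect_eq, rule continuous_on_entry, rule continuous_on_const)
  moreover have "setmul3 (Suc n) (Blow (Suc n)) (ins 0 j W) (Bup (Suc n)) \<subseteq> ?K"
  proof
    fix X assume "X \<in> setmul3 (Suc n) (Blow (Suc n)) (ins 0 j W) (Bup (Suc n))"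
    then obtain b c where bc: "b \<in> Blow (Suc n)" "c \<in> Bup (Suc n)"
      and X: "X = mmul (Suc n) b (mmul (Suc n) (ins 0 j W) c)"
      by (auto simp: setmul3_def mmul_assoc)
    have "X 0 k = b 0 0 * mmul (Suc n) (ins 0 j W) c 0 k"
      unfolding X using j bc mmul_skip[of 0 n k 0 b "mmul (Suc n) (ins 0 j W) c"]
      by (simp add: Blow_iff)
    also have "mmul (Suc n) (ins 0 j W) c 0 k = c j k"
      using j by (intro ins_mmul_row_0) auto
    also have "c j k = 0" using bc j by (simp add: Bup_iff upper_def)
    finally show "X \<in> ?K" by simp
  qed
  ultimately show ?thesis using A closure_minimal by blast
qed

lemma continuous_on_mdet_replace: "continuous_on S (\<lambda>A. mdet n (replace_e0 k A))"
proof -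
  have entry: "continuous_on S (\<lambda>A. replace_e0 k A i j)" for i j
    unfolding replace_e0_def by (cases "j = k") (simp_all add: continuous_on_entry)
  show ?thesis unfolding mdet_def
    by (rule continuous_on_sum, rule continuous_on_mult, rule continuous_on_const,
        rule continuous_on_prod, rule entry)
qed

text \<open>The span of the first \<open>i + 1\<close> columns contains the first coordinate vector; by Cramer's rule this is
the vanishing of polynomials in the entries, so it survives passing to the closure.\<close>
lemma schubert_up_cramer:
  assumes A: "A \<in> closure (setmul3 (Suc n) (Bup (Suc n)) (ins 0 i V) (Bup (Suc n)))"
    and i: "i \<le> n" "i < k" "k \<le> n"
  shows "mdet (Suc n) (replace_e0 k A) = 0"
proof -
  let ?K = "{A. mdet (Suc n) (replace_e0 k A) = 0}"
  have "closed ?K"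
    by (rule closed_Collect_eq, rule continuous_on_mdet_replace, rule continuous_on_const)
  moreover have "setmul3 (Suc n) (Bup (Suc n)) (ins 0 i V) (Bup (Suc n)) \<subseteq> ?K"
  proof
    fix X assume "X \<in> setmul3 (Suc n) (Bup (Suc n)) (ins 0 i V) (Bup (Suc n))"
    then obtain b c where bc: "b \<in> Bup (Suc n)" "c \<in> Bup (Suc n)"
      and X: "X = mmul (Suc n) (mmul (Suc n) b (ins 0 i V)) c"
      by (auto simp: setmul3_def)
    obtain d where d: "d \<in> Bup (Suc n)" "mmul (Suc n) c d = idm (Suc n)"
      using Bup_inverse[OF bc(2)] by blast
    have Xd: "mmul (Suc n) X d = mmul (Suc n) b (ins 0 i V)"
      unfolding X mmul_assoc[of "Suc n" _ c] d(2) by simp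
    have b00: "b 0 0 \<noteq> 0" using bc by (simp add: Bup_iff)
    have col: "mmul (Suc n) b (ins 0 i V) r i = (if r = 0 then b 0 0 else 0)" if "r < Suc n" for r
      using mmul_skip[of r n i 0 b "ins 0 i V"] that i bc(1) by (auto simp: Bup_iff upper_def)
    \<comment> \<open>Column \<open>i\<close> of \<open>X d\<close> is \<open>b 0 0\<close> times
      the first coordinate vector. So column \<open>i\<close> of \<open>d\<close> over
      \<open>b 0 0\<close> solves Cramer's system, and \<open>d k i = 0\<close> by
      triangularity.\<close>
    have "mdet (Suc n) (replace_e0 k X) = d k i / b 0 0 * mdet (Suc n) X"
    proof (rule mdet_replace_e0)
      fix r assume r: "r < Suc n"
      have "(\<Sum>l<Suc n. X r l * (d l i / b 0 0)) = mmul (Suc n) X d r i / b 0 0"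
        using r i by (simp add: mmul_def sum_divide_distrib del: sum.lessThan_Suc)
      then show "(\<Sum>l<Suc n. X r l * (d l i / b 0 0)) = (if r = 0 then 1 else 0)"
        unfolding Xd col[OF r] using b00 by simp
    qed (use i in simp)
    then show "X \<in> ?K" using d i by (simp add: Bup_iff upper_def)
  qed
  ultimately show ?thesis using A closure_minimal by blast
qed

text \<open>For invertible \<open>A\<close> the vanishing Cramer numerators say that the first
  column of the inverse is supported in the rows up to \<open>i\<close>.\<close>

lemma e0_solution:
  assumes A: "A \<in> GLn (Suc n)"
    "A \<in> closure (setmul3 (Suc n) (Bup (Suc n)) (ins 0 i V) (Bup (Suc n)))" and i: "i \<le> n"
  obtains x where "\<And>r. r < Suc n \<Longrightarrow> (\<Sum>k<Suc n. A r k * x k) = (if r = 0 then 1 else 0)"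
    "\<And>k. i < k \<Longrightarrow> x k = 0"
proof -
  obtain D where D: "D \<in> GLn (Suc n)" "mmul (Suc n) A D = idm (Suc n)"
    using GLn_inverse[OF A(1)] by blast
  have sol: "(\<Sum>k<Suc n. A r k * D k 0) = (if r = 0 then 1 else 0)" if "r < Suc n" for r
  proof -
    have "mmul (Suc n) A D r 0 = (\<Sum>k<Suc n. A r k * D k 0)" using that by (simp only: mmul_def) simp
    then show ?thesis using that D(2) by (simp add: idm_def del: sum.lessThan_Suc)
  qed
  have D0: "D k 0 = 0" if "i < k" for k
  proof (cases "k < Suc n")
    case True
    then have "mdet (Suc n) (replace_e0 k A) = D k 0 * mdet (Suc n) A"
      by (rule mdet_replace_e0) (rule sol)
    moreover have "mdet (Suc n) (replace_e0 k A) = 0"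
      using True that i by (intro schubert_up_cramer[OF A(2)]) auto
    ultimately show ?thesis using A(1) by (simp add: GLn_def)
  next
    case False
    then show ?thesis using D(1) by (auto simp: GLn_def mats_def)
  qed
  show thesis by (rule that[of "\<lambda>k. D k 0"]) (simp_all only: sol D0)
qed

text \<open>As \<open>A x\<close> is the first coordinate vector, subtracting \<open>c\<close> times
  this combination from column \<open>k\<close> changes only its first entry; this is how the first
  row gets cleared.\<close>

lemma mmul_column_op:
  assumes "r < Suc n" "k < Suc n"
    and x: "\<And>r. r < Suc n \<Longrightarrow> (\<Sum>k<Suc n. A r k * x k) = (if r = 0 then 1 else 0)"
    and q: "\<And>s. s < Suc n \<Longrightarrow> q s k = (if s = k then 1 else 0) - c * x s"
  shows "mmul (Suc n) A q r k = A r k - (if r = 0 then c else 0)"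
proof -
  have "mmul (Suc n) A q r k = (\<Sum>s<Suc n. A r s * q s k)"
    using assms by (simp only: mmul_def) simp
  also have "\<dots> = (\<Sum>s<Suc n. (if s = k then A r k else 0) - c * (A r s * x s))"
    by (intro sum.cong) (auto simp: q algebra_simps)
  also have "\<dots> = A r k - c * (\<Sum>s<Suc n. A r s * x s)"
    using assms(2) by (simp add: sum_subtractf sum_distrib_left del: sum.lessThan_Suc)
  finally show ?thesis using x[OF assms(1)] by simp
qed

lemma richardson_factor_R:
  assumes A: "A \<in> GLn (Suc n)"
    and up: "A \<in> closure (setmul3 (Suc n) (Bup (Suc n)) (ins 0 j V) (Bup (Suc n)))"
    and low: "A \<in> closure (setmul3 (Suc n) (Blow (Suc n)) (ins 0 j W) (Bup (Suc n)))"
    and j: "j \<le> n"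
  obtains A' b where "A' \<in> mats n" "b \<in> Bup (Suc n)" "A = mmul (Suc n) (ins 0 j A') b"
proof -
  obtain x where x: "\<And>r. r < Suc n \<Longrightarrow> (\<Sum>k<Suc n. A r k * x k) = (if r = 0 then 1 else 0)"
    and x0: "\<And>k. j < k \<Longrightarrow> x k = 0"
    using e0_solution[OF A up j] by blast
  have A0: "A 0 k = 0" if "k < j" for k using schubert_low_row[OF low j that] .
  \<comment> \<open>The first row vanishes left of \<open>j\<close> and \<open>x\<close> right of
    \<open>j\<close>, so a single product survives and the pivot is nonzero.\<close>
  have "(\<Sum>k<Suc n. A 0 k * x k) = (\<Sum>k<Suc n. if k = j then A 0 j * x j else 0)"
    using x0 A0 by (intro sum.cong refl) (metis linorder_neqE_nat mult_zero_left mult_zero_right)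
  then have Aj: "A 0 j * x j = 1" using x[of 0] j by (simp del: sum.lessThan_Suc)
  \<comment> \<open>Column \<open>j\<close> becomes \<open>A x\<close>, the first coordinate vector,
    and each later column loses \<open>A 0 k\<close> copies of it. As \<open>x\<close> stops at
    \<open>j\<close>, \<open>q\<close> is upper triangular.\<close>
  define q where "q = (\<lambda>r k. if n < r \<or> n < k then 0 else if k = j then x r
    else (if r = k then 1 else 0) - (if j < k then A 0 k else 0) * x r)"
  have q: "q \<in> Bup (Suc n)"
    using x0 Aj by (auto simp: Bup_iff upper_def mats_def q_def)
  have colj: "mmul (Suc n) A q r j = (if r = 0 then 1 else 0)" if "r < Suc n" for r
  proof -
    have "mmul (Suc n) A q r j = (\<Sum>k<Suc n. A r k * q k j)"
      using that j by (simp only: mmul_def) simp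
    also have "\<dots> = (\<Sum>k<Suc n. A r k * x k)"
      by (intro sum.cong) (use j in \<open>auto simp: q_def\<close>)
    finally show ?thesis using x[OF that] by simp
  qed
  have row: "mmul (Suc n) A q 0 k = 0" if "k < Suc n" "k \<noteq> j" for k
  proof -
    have "mmul (Suc n) A q 0 k = A 0 k - (if (0::nat) = 0 then if j < k then A 0 k else 0 else 0)"
      by (rule mmul_column_op[OF _ that(1) x]) (use that in \<open>auto simp: q_def\<close>)
    then show ?thesis using A0 that by auto
  qed
  have ins: "ins 0 j (del 0 j (mmul (Suc n) A q)) = mmul (Suc n) A q"
    by (rule ins_del[of _ n]) (use j colj row in auto)
  obtain b where b: "b \<in> Bup (Suc n)" "mmul (Suc n) q b = idm (Suc n)"
    using Bup_inverse[OF q] by blast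
  show thesis
  proof
    show "A = mmul (Suc n) (ins 0 j (del 0 j (mmul (Suc n) A q))) b"
      unfolding ins mmul_assoc b(2) using A by (simp add: GLn_mats)
    show "del 0 j (mmul (Suc n) A q) \<in> mats n" using j by (simp add: del_mats)
  qed fact
qed

lemma richardson_factor_T:
  assumes A: "A \<in> GLn (Suc n)"
    and up: "A \<in> closure (setmul3 (Suc n) (Bup (Suc n)) (ins 0 (Suc j) V) (Bup (Suc n)))"
    and low: "A \<in> closure (setmul3 (Suc n) (Blow (Suc n)) (ins 0 j W) (Bup (Suc n)))"
    and j: "Suc j \<le> n"
  obtains A' b \<alpha> \<beta> \<gamma> \<delta> where "A' \<in> mats n" "b \<in> Bup (Suc n)" "\<alpha> * \<delta> - \<beta> * \<gamma> \<noteq> 0"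
    "A = mmul (Suc n) (mmul (Suc n) (ins 0 j A') (blk (Suc n) j \<alpha> \<beta> \<gamma> \<delta>)) b"
proof -
  let ?N = "Suc n"
  have jn: "j \<le> n" "Suc j < ?N" "j < ?N" using j by auto
  obtain x where x: "\<And>r. r < ?N \<Longrightarrow> (\<Sum>k<?N. A r k * x k) = (if r = 0 then 1 else 0)"
    and x0: "\<And>k. Suc j < k \<Longrightarrow> x k = 0"
    using e0_solution[OF A up j] by blast
  have A0: "A 0 k = 0" if "k < j" for k using schubert_low_row[OF low jn(1) that] .
  \<comment> \<open>Here the supports of the first row and of \<open>x\<close> can overlap in the
    two places \<open>j\<close> and \<open>j + 1\<close>.\<close>
  have "A 0 k * x k = (if k = j then A 0 j * x j else 0) + (if k = Suc j then A 0 (Suc j) * x (Suc j) else 0)" for k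
  proof -
    consider "k < j" | "k = j" | "k = Suc j" | "Suc j < k" by linarith
    then show ?thesis by cases (simp_all add: A0 x0)
  qed
  then have "(\<Sum>k<?N. A 0 k * x k) = (\<Sum>k<?N. (if k = j then A 0 j * x j else 0) +
      (if k = Suc j then A 0 (Suc j) * x (Suc j) else 0))"
    by (intro sum.cong refl)
  also have "\<dots> = A 0 j * x j + A 0 (Suc j) * x (Suc j)"
    using jn by (simp add: sum.distrib del: sum.lessThan_Suc)
  finally have Aj: "A 0 j * x j + A 0 (Suc j) * x (Suc j) = 1" using x[of 0] by simp
  \<comment> \<open>Column \<open>j\<close> is \<open>x\<close> as for \<open>R\<close>. Column
    \<open>j + 1\<close> is the combination of the columns \<open>j\<close> and \<open>j + 1\<close>
    of \<open>A\<close> that kills the first row; this block of \<open>q\<close> has as determinant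
    the sum in \<open>Aj\<close>, that is, 1.\<close>
  define q where "q = (\<lambda>r k. if n < r \<or> n < k then 0 else if k = j then x r
    else if k = Suc j then (if r = j then - A 0 (Suc j) else if r = Suc j then A 0 j else 0)
    else (if r = k then 1 else 0) - (if j < k then A 0 k else 0) * x r)"
  have q: "q \<in> pshape ?N j"
    using x0 by (auto simp: pshape_def mats_def q_def)
  have colj: "mmul ?N A q r j = (if r = 0 then 1 else 0)" if "r < ?N" for r
  proof -
    have "mmul ?N A q r j = (\<Sum>k<?N. A r k * q k j)"
      using that jn by (simp only: mmul_def) simp
    also have "\<dots> = (\<Sum>k<?N. A r k * x k)"
      by (intro sum.cong) (use j in \<open>auto simp: q_def\<close>)
    finally show ?thesis using x[OF that] by simp
  qed
  have row: "mmul ?N A q 0 k = 0" if "k < ?N" "k \<noteq> j" for k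
  proof (cases "k = Suc j")
    case True
    have "mmul ?N A q 0 k = (\<Sum>s<?N. A 0 s * q s k)"
      using that by (simp only: mmul_def) simp
    also have "\<dots> = (\<Sum>s<?N. (if s = j then - A 0 j * A 0 (Suc j) else 0) +
        (if s = Suc j then A 0 j * A 0 (Suc j) else 0))"
      by (intro sum.cong) (use True that in \<open>auto simp: q_def\<close>)
    also have "\<dots> = 0" using jn by (simp add: sum.distrib del: sum.lessThan_Suc)
    finally show ?thesis .
  next
    case False
    have "mmul ?N A q 0 k = A 0 k - (if (0::nat) = 0 then if j < k then A 0 k else 0 else 0)"
      by (rule mmul_column_op[OF _ that(1) x]) (use that False in \<open>auto simp: q_def\<close>)
    then show ?thesis using A0 that by auto
  qed
  have ins: "ins 0 j (del 0 j (mmul ?N A q)) = mmul ?N A q"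
    by (rule ins_del[of _ n]) (use jn colj row in auto)
  \<comment> \<open>\<open>?g\<close> is the block of \<open>q\<close> on \<open>j\<close> and
    \<open>j + 1\<close>. Multiplying \<open>q\<close> by the inverse \<open>?h\<close> of
    \<open>?g\<close> leaves an upper triangular matrix with unit diagonal, whose inverse is the
    factor in \<open>Bup\<close>.\<close>
  let ?g = "blk ?N j (x j) (x (Suc j)) (- A 0 (Suc j)) (A 0 j)"
  have "x j * A 0 j - x (Suc j) * (- A 0 (Suc j)) \<noteq> 0" using Aj by (simp add: algebra_simps)
  from blk_inverse[OF this jn(2)] obtain \<alpha> \<beta> \<gamma> \<delta> where abcd: "\<alpha> * \<delta> - \<beta> * \<gamma> \<noteq> 0"
    and inv1: "mmul ?N ?g (blk ?N j \<alpha> \<beta> \<gamma> \<delta>) = idm ?N"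
    and inv2: "mmul ?N (blk ?N j \<alpha> \<beta> \<gamma> \<delta>) ?g = idm ?N" by metis
  let ?h = "blk ?N j \<alpha> \<beta> \<gamma> \<delta>"
  have e: "mmul ?N ?g ?h i k = idm ?N i k" for i k using inv1 by simp
  have b: "mmul ?N q ?h i k = idm ?N i k" if "i \<in> {j, Suc j}" "k \<in> {j, Suc j}" for i k
  proof -
    have ik: "i < ?N" "k < ?N" using that jn by auto
    have "mmul ?N q ?h i k = mmul ?N ?g ?h i k"
      unfolding mmul_blk[OF ik jn(2)] using that jn by (auto simp: q_def blk_def)
    then show ?thesis using e by simp
  qed
  have diag: "mmul ?N q ?h i i = 1" if "i < ?N" for i
  proof (cases "i \<in> {j, Suc j}")
    case True
    then show ?thesis using b[of i i] that by (simp add: idm_def)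
  next
    case False
    then have "mmul ?N q ?h i i = q i i"
      using mmul_blk[OF that that jn(2)] by simp
    also have "\<dots> = 1" using False that x0[of i] by (auto simp: q_def)
    finally show ?thesis .
  qed
  have "mmul ?N q ?h \<in> upper ?N"
    unfolding upper_pshape_iff[of _ _ j] using b[of "Suc j" j]
    by (auto intro: pshape_mmul q blk_pshape simp: idm_def)
  then have B: "mmul ?N q ?h \<in> Bup ?N" using diag by (simp add: Bup_iff)
  obtain c where c: "c \<in> Bup ?N" "mmul ?N (mmul ?N q ?h) c = idm ?N"
    using Bup_inverse[OF B] by blast
  show thesis
  proof
    show "A = mmul ?N (mmul ?N (ins 0 j (del 0 j (mmul ?N A q))) ?h) c"
      unfolding ins using c(2) A by (simp add: mmul_assoc GLn_mats)
    show "del 0 j (mmul ?N A q) \<in> mats n" using jn by (simp add: del_mats)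
  qed fact+
qed

text \<open>Arbitrary matrices replace the permutation matrices, since the recursion mainly uses
  that they arise by insertion.\<close>

definition rich :: "nat \<Rightarrow> cmat \<Rightarrow> cmat \<Rightarrow> cmat set" where
  "rich n U V = GLn n \<inter> closure (setmul3 n (Bup n) V (Bup n)) \<inter> closure (setmul3 n (Blow n) U (Bup n))"

lemma Richardson_eq_rich: "Richardson n u v = rich n (pmat n u) (pmat n v)"
  by (auto simp: Richardson_def SchubUp_def SchubLow_def rich_def)

definition attach_R :: "nat \<Rightarrow> nat \<Rightarrow> cmat set \<Rightarrow> cmat set" where
  "attach_R n j S = {mmul (Suc n) (ins 0 j A) b | A b. A \<in> S \<and> b \<in> Bup (Suc n)}"

definition attach_T :: "nat \<Rightarrow> nat \<Rightarrow> cmat set \<Rightarrow> cmat set" where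
  "attach_T n j S = {mmul (Suc n) (mmul (Suc n) (ins 0 j A) (blk (Suc n) j \<alpha> \<beta> \<gamma> \<delta>)) b
     | A \<alpha> \<beta> \<gamma> \<delta> b. A \<in> S \<and> \<alpha> * \<delta> - \<beta> * \<gamma> \<noteq> 0 \<and> b \<in> Bup (Suc n)}"

lemma rich_attach_R:
  assumes j: "j \<le> n"
  shows "rich (Suc n) (ins 0 j U) (ins 0 j V) = attach_R n j (rich n U V)"
proof (intro Set.set_eqI iffI)
  fix A assume "A \<in> rich (Suc n) (ins 0 j U) (ins 0 j V)"
  then have A: "A \<in> GLn (Suc n)"
    and up: "A \<in> closure (setmul3 (Suc n) (Bup (Suc n)) (ins 0 j V) (Bup (Suc n)))"
    and low: "A \<in> closure (setmul3 (Suc n) (Blow (Suc n)) (ins 0 j U) (Bup (Suc n)))"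
    by (auto simp: rich_def)
  obtain A' b where A': "A' \<in> mats n" and b: "b \<in> Bup (Suc n)" and eq: "A = mmul (Suc n) (ins 0 j A') b"
    by (rule richardson_factor_R[OF A up low j])
  obtain q where q: "q \<in> Bup (Suc n)" "mmul (Suc n) b q = idm (Suc n)" using Bup_inverse[OF b] by blast
  have Aq: "mmul (Suc n) A q = ins 0 j A'"
    unfolding eq mmul_assoc q(2) using j A' by (simp add: ins_mats)
  have "mmul (Suc n) A q \<in> GLn (Suc n)" by (intro GLn_mmul A Bup_GLn q)
  then have "A' \<in> GLn n" unfolding Aq using ins_GLn_iff[OF j A'] by simp
  \<comment> \<open>On \<open>ins 0 j A'\<close> both deletion and Schur complement return
    \<open>A'\<close>.\<close>
  moreover have "A' \<in> closure (setmul3 n (Bup n) V (Bup n))"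
    using del_closure_up[OF up Bup_pshape[OF q(1)], of j] j by (simp add: Aq)
  moreover have "A' \<in> closure (setmul3 n (Blow n) U (Bup n))"
    using schur_closure_low[OF low Bup_pshape[OF q(1)] j] by (simp add: Aq)
  ultimately have "A' \<in> rich n U V" by (simp add: rich_def)
  then show "A \<in> attach_R n j (rich n U V)" using eq b by (auto simp: attach_R_def)
next
  fix A assume "A \<in> attach_R n j (rich n U V)"
  then obtain A' b where A': "A' \<in> rich n U V" and b: "b \<in> Bup (Suc n)"
    and eq: "A = mmul (Suc n) (ins 0 j A') b"
    by (auto simp: attach_R_def)
  have "A' \<in> GLn n" using A' by (simp add: rich_def)
  then have "ins 0 j A' \<in> GLn (Suc n)" using ins_GLn_iff[OF j] GLn_mats by blast
  then have "A \<in> GLn (Suc n)" unfolding eq by (rule GLn_mmul[OF _ Bup_GLn[OF b]])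
  moreover have "A \<in> closure (setmul3 (Suc n) (Bup (Suc n)) (ins 0 j V) (Bup (Suc n)))"
    using A' unfolding eq rich_def
    by (intro setmul3_closure_mmul[OF ins_setmul3[where P = Bup] b] j ins_Bup) auto
  moreover have "A \<in> closure (setmul3 (Suc n) (Blow (Suc n)) (ins 0 j U) (Bup (Suc n)))"
    using A' unfolding eq rich_def
    by (intro setmul3_closure_mmul[OF ins_setmul3[where P = Blow] b] j ins_Blow) auto
  ultimately show "A \<in> rich (Suc n) (ins 0 j U) (ins 0 j V)" by (simp add: rich_def)
qed

lemma rich_attach_T:
  assumes j: "Suc j \<le> n" and V: "V \<in> GLn n"
  shows "rich (Suc n) (ins 0 j U) (ins 0 (Suc j) V) = attach_T n j (rich n U V)"
proof (intro Set.set_eqI iffI)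
  have jn: "j \<le> n" "Suc j < Suc n" using j by auto
  {
    fix A assume "A \<in> rich (Suc n) (ins 0 j U) (ins 0 (Suc j) V)"
    then have A: "A \<in> GLn (Suc n)"
      and up: "A \<in> closure (setmul3 (Suc n) (Bup (Suc n)) (ins 0 (Suc j) V) (Bup (Suc n)))"
      and low: "A \<in> closure (setmul3 (Suc n) (Blow (Suc n)) (ins 0 j U) (Bup (Suc n)))"
      by (auto simp: rich_def)
    obtain A' b \<alpha> \<beta> \<gamma> \<delta> where A': "A' \<in> mats n" and b: "b \<in> Bup (Suc n)"
      and D: "\<alpha> * \<delta> - \<beta> * \<gamma> \<noteq> 0"
      and eq: "A = mmul (Suc n) (mmul (Suc n) (ins 0 j A') (blk (Suc n) j \<alpha> \<beta> \<gamma> \<delta>)) b"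
      by (rule richardson_factor_T[OF A up low j])
    obtain q where q: "q \<in> Bup (Suc n)" "mmul (Suc n) b q = idm (Suc n)"
      using Bup_inverse[OF b] by blast
    obtain x y z w where D': "x * w - y * z \<noteq> 0"
      and inv: "mmul (Suc n) (blk (Suc n) j \<alpha> \<beta> \<gamma> \<delta>) (blk (Suc n) j x y z w) = idm (Suc n)"
      using blk_inverse[OF D jn(2)] by metis
    \<comment> \<open>The inverse of the block times \<open>b\<close>: it has parabolic shape and
      undoes the whole right factor of \<open>A\<close>.\<close>
    let ?q = "mmul (Suc n) q (blk (Suc n) j x y z w)"
    have q': "?q \<in> pshape (Suc n) j" by (intro pshape_mmul blk_pshape Bup_pshape q)
    have "mmul (Suc n) A ?q = mmul (Suc n) (ins 0 j A') (mmul (Suc n) (blk (Suc n) j \<alpha> \<beta> \<gamma> \<delta>)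
        (mmul (Suc n) (mmul (Suc n) b q) (blk (Suc n) j x y z w)))"
      unfolding eq mmul_assoc ..
    also have "\<dots> = ins 0 j A'" unfolding q(2) using jn A' by (simp add: ins_mats inv)
    finally have Aq: "mmul (Suc n) A ?q = ins 0 j A'" .
    have "mmul (Suc n) A ?q \<in> GLn (Suc n)"
      by (rule GLn_mmul[OF A GLn_mmul[OF Bup_GLn[OF q(1)] blk_GLn[OF D' jn(2)]]])
    then have "A' \<in> GLn n" unfolding Aq using ins_GLn_iff[OF jn(1) A'] by simp
    moreover have "A' \<in> closure (setmul3 n (Bup n) V (Bup n))"
      using del_closure_up[OF up q'] j by (simp add: Aq)
    moreover have "A' \<in> closure (setmul3 n (Blow n) U (Bup n))"
      using schur_closure_low[OF low q' jn(1)] by (simp add: Aq)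
    ultimately have "A' \<in> rich n U V" by (simp add: rich_def)
    then show "A \<in> attach_T n j (rich n U V)" using eq b D unfolding attach_T_def by blast
  }
  {
    fix A assume "A \<in> attach_T n j (rich n U V)"
    then obtain A' b \<alpha> \<beta> \<gamma> \<delta> where A': "A' \<in> rich n U V" and b: "b \<in> Bup (Suc n)"
      and D: "\<alpha> * \<delta> - \<beta> * \<gamma> \<noteq> 0"
      and eq: "A = mmul (Suc n) (mmul (Suc n) (ins 0 j A') (blk (Suc n) j \<alpha> \<beta> \<gamma> \<delta>)) b"
      unfolding attach_T_def by blast
    have A'': "A' \<in> GLn n" "A' \<in> closure (setmul3 n (Bup n) V (Bup n))"
      "A' \<in> closure (setmul3 n (Blow n) U (Bup n))" using A' by (simp_all add: rich_def)
    then have "ins 0 j A' \<in> GLn (Suc n)" using ins_GLn_iff[OF jn(1)] GLn_mats by blast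
    then have "A \<in> GLn (Suc n)" unfolding eq
      by (intro GLn_mmul[OF GLn_mmul] blk_GLn[OF D jn(2)] Bup_GLn[OF b])
    moreover have "A \<in> closure (setmul3 (Suc n) (Bup (Suc n)) (ins 0 (Suc j) V) (Bup (Suc n)))"
      unfolding eq by (intro setmul3_closure_mmul[OF ins_blk_up] b j V A'')
    moreover have "A \<in> closure (setmul3 (Suc n) (Blow (Suc n)) (ins 0 j U) (Bup (Suc n)))"
      unfolding eq by (intro setmul3_closure_mmul[OF ins_blk_low] b j A'')
    ultimately show "A \<in> rich (Suc n) (ins 0 j U) (ins 0 (Suc j) V)" by (simp add: rich_def)
  }
qed

subsection \<open>Torus orbits\<close>

lemma mmul_Torus_left:
  assumes "t \<in> Torus n" "i < n" "k < n"
  shows "mmul n t M i k = t i i * M i k"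
proof -
  have "(\<Sum>l<n. t i l * M l k) = (\<Sum>l<n. if l = i then t i i * M i k else 0)"
    using assms by (intro sum.cong) (auto simp: Torus_iff)
  then show ?thesis using assms by (simp add: mmul_def)
qed

lemma mmul_Torus_right:
  assumes "t \<in> Torus n" "i < n" "k < n"
  shows "mmul n M t i k = M i k * t k k"
proof -
  have "(\<Sum>l<n. M i l * t l k) = (\<Sum>l<n. if l = k then M i k * t k k else 0)"
    using assms by (intro sum.cong) (auto simp: Torus_iff)
  then show ?thesis using assms by (simp add: mmul_def)
qed

definition dg :: "nat \<Rightarrow> nat \<Rightarrow> complex \<Rightarrow> cmat" where
  "dg n j s = (\<lambda>i k. if i < n \<and> i = k then if i = j then s else 1 else 0)"

lemma dg_Torus: "s \<noteq> 0 \<Longrightarrow> dg n j s \<in> Torus n"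
  by (auto simp: Torus_iff mats_def dg_def)

lemma Torus_Bup: "t \<in> Torus n \<Longrightarrow> t \<in> Bup n"
  by (auto simp: Torus_iff Bup_iff upper_def)

lemma Torus_mmul:
  assumes "s \<in> Torus n" "t \<in> Torus n"
  shows "mmul n s t \<in> Torus n"
proof -
  have e: "mmul n s t i k = (if i < n \<and> k < n then s i i * t i k else 0)" for i k
    using mmul_Torus_left[OF assms(1), of i k t] by (auto simp: mmul_def)
  show ?thesis using assms by (auto simp: Torus_iff e)
qed

lemma dg_mmul_dg: "s * s' = 1 \<Longrightarrow> mmul n (dg n j s) (dg n j s') = idm n"
proof (rule mats_eqI[of _ n])
  fix i k assume s: "s * s' = 1" and ik: "i < n" "k < n"
  have "s \<noteq> 0" using s by auto
  then show "mmul n (dg n j s) (dg n j s') i k = idm n i k"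
    using s ik by (subst mmul_Torus_left) (auto simp: dg_Torus, auto simp: dg_def idm_def)
qed simp_all

text \<open>The pivot is the only nonzero entry of its row and of its column, so the first torus
  coordinate can be passed to the right, to column \<open>j\<close>; the others act on
  \<open>A\<close>.\<close>

lemma Torus_mmul_ins:
  assumes t: "t \<in> Torus (Suc n)" and j: "j \<le> n"
  shows "mmul (Suc n) t (ins 0 j A) = mmul (Suc n) (ins 0 j (mmul n (del 0 0 t) A)) (dg (Suc n) j (t 0 0))"
proof (rule mats_eqI[of _ "Suc n"])
  fix i k assume ik: "i < Suc n" "k < Suc n"
  have t0: "t 0 0 \<noteq> 0" using t by (simp add: Torus_iff)
  have t': "del 0 0 t \<in> Torus n" using t by (simp add: del_Torus)
  note eqs = mmul_Torus_left[OF t] mmul_Torus_right[OF dg_Torus[OF t0]] mmul_Torus_left[OF t']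
  show "mmul (Suc n) t (ins 0 j A) i k =
      mmul (Suc n) (ins 0 j (mmul n (del 0 0 t) A)) (dg (Suc n) j (t 0 0)) i k"
  proof (rule skip_cases[OF ik(2) j])
    assume "k = j"
    then show ?thesis using ik j by (cases i) (simp_all add: eqs, simp_all add: dg_def)
  next
    fix k' assume "k' < n" "k = skip j k'"
    then show ?thesis using ik j by (cases i) (simp_all add: eqs, simp_all add: dg_def del_def)
  qed
qed simp_all

text \<open>Passed to the right, the new torus coordinate turns \<alpha>:\<beta> into
  \<open>s\<close>\<alpha>:\<beta>, with fixed points \<alpha> = 0 and \<beta> = 0 and one further
  orbit.\<close>

lemma dg_mmul_blk:
  assumes "s \<noteq> 0"
  shows "mmul n (dg n j s) (blk n j \<alpha> \<beta> \<gamma> \<delta>) = blk n j (s * \<alpha>) \<beta> (s * \<gamma>) \<delta>"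
proof (rule mats_eqI[of _ n])
  fix i k assume ik: "i < n" "k < n"
  show "mmul n (dg n j s) (blk n j \<alpha> \<beta> \<gamma> \<delta>) i k = blk n j (s * \<alpha>) \<beta> (s * \<gamma>) \<delta> i k"
    unfolding mmul_Torus_left[OF dg_Torus[OF assms] ik] using ik by (auto simp: blk_def dg_def)
qed simp_all

lemma blk_mmul_row:
  assumes "Suc j < n" "k < n"
  shows "mmul n (blk n j \<alpha> \<beta> \<gamma> \<delta>) M (Suc j) k = \<beta> * M j k + \<delta> * M (Suc j) k"
proof -
  have "(\<Sum>l<n. blk n j \<alpha> \<beta> \<gamma> \<delta> (Suc j) l * M l k) =
      (\<Sum>l<n. (if l = j then \<beta> * M j k else 0) + (if l = Suc j then \<delta> * M (Suc j) k else 0))"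
    using assms by (intro sum.cong) (auto simp: blk_def)
  then show ?thesis using assms by (simp add: mmul_def sum.distrib)
qed

lemma blk_1: "blk n j 1 0 0 1 = idm n"
  by (intro ext) (auto simp: blk_def idm_def)

text \<open>Moving the pivot from \<open>j\<close> to \<open>j + 1\<close> swaps two columns, so
  \<alpha> = 0 takes the shape of \<beta> = 0 with the pivot at \<open>j + 1\<close>.\<close>

lemma ins_mmul_blk_swap:
  assumes "Suc j \<le> n"
  shows "mmul (Suc n) (ins 0 (Suc j) A) (blk (Suc n) j \<beta> \<alpha> \<delta> \<gamma>) =
    mmul (Suc n) (ins 0 j A) (blk (Suc n) j \<alpha> \<beta> \<gamma> \<delta>)"
proof (rule mats_eqI[of _ "Suc n"])
  fix i k assume ik: "i < Suc n" "k < Suc n"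
  have j: "Suc j < Suc n" using assms by simp
  show "mmul (Suc n) (ins 0 (Suc j) A) (blk (Suc n) j \<beta> \<alpha> \<delta> \<gamma>) i k =
      mmul (Suc n) (ins 0 j A) (blk (Suc n) j \<alpha> \<beta> \<gamma> \<delta>) i k"
    unfolding mmul_blk[OF ik j] by (auto simp: ins_def unskip_def)
qed simp_all

section \<open>Splitting the projective line under the torus\<close>

definition attach_T_open :: "nat \<Rightarrow> nat \<Rightarrow> cmat set \<Rightarrow> cmat set" where
  "attach_T_open n j S = {mmul (Suc n) (mmul (Suc n) (ins 0 j A) (blk (Suc n) j \<alpha> \<beta> \<gamma> \<delta>)) b
     | A \<alpha> \<beta> \<gamma> \<delta> b. A \<in> S \<and> \<alpha> \<noteq> 0 \<and> \<beta> \<noteq> 0 \<and> \<alpha> * \<delta> - \<beta> * \<gamma> \<noteq> 0 \<and> b \<in> Bup (Suc n)}"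

lemma attach_T_decomp:
  assumes j: "Suc j \<le> n" and S: "S \<subseteq> mats n"
  shows "attach_T n j S = attach_T_open n j S \<union> attach_R n j S \<union> attach_R n (Suc j) S"
proof (intro equalityI subsetI)
  let ?N = "Suc n"
  have j': "Suc j < ?N" using j by simp
  fix X assume "X \<in> attach_T n j S"
  then obtain A \<alpha> \<beta> \<gamma> \<delta> b where A: "A \<in> S" and D: "\<alpha> * \<delta> - \<beta> * \<gamma> \<noteq> 0" and b: "b \<in> Bup ?N"
    and X: "X = mmul ?N (mmul ?N (ins 0 j A) (blk ?N j \<alpha> \<beta> \<gamma> \<delta>)) b"
    unfolding attach_T_def by blast
  have up: "blk ?N j x 0 y z \<in> Bup ?N" if "x * z - 0 * y \<noteq> 0" for x y z
    using blk_upper blk_GLn[OF that j'] by (auto simp: Bup_def GLn_def upper_def)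
  \<comment> \<open>With \<beta> = 0 the block is absorbed into \<open>Bup\<close>; with \<alpha> =
    0 the same happens after the swap. These give the pivots at \<open>j\<close> and at
    \<open>j + 1\<close>.\<close>
  consider "\<alpha> \<noteq> 0" "\<beta> \<noteq> 0" | "\<beta> = 0" | "\<alpha> = 0" by blast
  then show "X \<in> attach_T_open n j S \<union> attach_R n j S \<union> attach_R n (Suc j) S"
  proof cases
    case 1
    then have "X \<in> attach_T_open n j S" using A D b X unfolding attach_T_open_def by blast
    then show ?thesis by blast
  next
    case 2
    then have "mmul ?N (blk ?N j \<alpha> \<beta> \<gamma> \<delta>) b \<in> Bup ?N" using D by (intro Bup_mmul b) (auto intro: up)
    then have "X \<in> attach_R n j S" using A unfolding X mmul_assoc attach_R_def by blast
    then show ?thesis by blast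
  next
    case 3
    then have "mmul ?N (blk ?N j \<beta> \<alpha> \<delta> \<gamma>) b \<in> Bup ?N" using D by (intro Bup_mmul b) (auto intro: up)
    then have "X \<in> attach_R n (Suc j) S" using A
      unfolding X ins_mmul_blk_swap[OF j, symmetric] mmul_assoc attach_R_def by blast
    then show ?thesis by blast
  qed
next
  let ?N = "Suc n"
  fix X assume "X \<in> attach_T_open n j S \<union> attach_R n j S \<union> attach_R n (Suc j) S"
  then consider "X \<in> attach_T_open n j S" | "X \<in> attach_R n j S" | "X \<in> attach_R n (Suc j) S" by blast
  then show "X \<in> attach_T n j S"
  proof cases
    case 1 then show ?thesis unfolding attach_T_open_def attach_T_def by blast
  next
    case 2
    then obtain A b where A: "A \<in> S" "b \<in> Bup ?N" "X = mmul ?N (ins 0 j A) b"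
      unfolding attach_R_def by blast
    have "ins 0 j A \<in> mats ?N" using A S j by (intro ins_mats) auto
    then have "X = mmul ?N (mmul ?N (ins 0 j A) (blk ?N j 1 0 0 1)) b" using A by (simp add: blk_1)
    moreover have "1 * 1 - 0 * 0 \<noteq> (0::complex)" by simp
    ultimately show ?thesis using A(1,2) unfolding attach_T_def by blast
  next
    case 3
    then obtain A b where A: "A \<in> S" "b \<in> Bup ?N" "X = mmul ?N (ins 0 (Suc j) A) b"
      unfolding attach_R_def by blast
    have "ins 0 (Suc j) A \<in> mats ?N" using A S j by (intro ins_mats) auto
    then have "X = mmul ?N (mmul ?N (ins 0 (Suc j) A) (blk ?N j 1 0 0 1)) b" using A by (simp add: blk_1)
    then have "X = mmul ?N (mmul ?N (ins 0 j A) (blk ?N j 0 1 1 0)) b"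
      unfolding ins_mmul_blk_swap[OF j] .
    moreover have "0 * 0 - 1 * 1 \<noteq> (0::complex)" by simp
    ultimately show ?thesis using A(1,2) unfolding attach_T_def by blast
  qed
qed

text \<open>Words are read from the last letter, as in \<open>uv_rev\<close>.\<close>

fun valid :: "letter list \<Rightarrow> bool" where
  "valid [] = True"
| "valid (R j # xs) = (1 \<le> j \<and> j \<le> Suc (length xs) \<and> valid xs)"
| "valid (T j # xs) = (1 \<le> j \<and> j \<le> length xs \<and> valid xs)"

text \<open>By \<open>cell_eq_orbit\<close>, the preimage of a single torus orbit. A letter
  \<open>T\<close> records a generic point on its projective line; \<open>j - 1\<close> converts to
  columns counted from 0.\<close>

fun cell :: "letter list \<Rightarrow> cmat set" where
  "cell [] = GLn 0"
| "cell (R j # xs) = attach_R (length xs) (j - 1) (cell xs)"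
| "cell (T j # xs) = attach_T_open (length xs) (j - 1) (cell xs)"

definition Xr :: "letter list \<Rightarrow> cmat set" where
  "Xr xs = Richardson (length xs) (fst (uv_rev xs)) (snd (uv_rev xs))"

lemma Xvar_eq_Xr: "Xvar \<Omega> = Xr (rev \<Omega>)"
  by (simp add: Xvar_def Xr_def uv_def)

lemma RTSeq_valid: "\<Omega> \<in> RTSeq n \<Longrightarrow> valid (rev \<Omega>)"
proof (induction \<Omega> arbitrary: n rule: rev_induct)
  case (snoc x xs)
  let ?ok = "\<lambda>l k. case l of R j \<Rightarrow> 1 \<le> j \<and> j \<le> Suc k | T j \<Rightarrow> 1 \<le> j \<and> j \<le> k"
  have n: "n = Suc (length xs)" and ok: "\<And>k. k < n \<Longrightarrow> ?ok ((xs @ [x]) ! k) k"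
    using snoc.prems by (auto simp: RTSeq_def)
  have "?ok (xs ! k) k" if "k < length xs" for k
    using ok[of k] that n by (simp add: nth_append)
  then have "xs \<in> RTSeq (length xs)" by (simp add: RTSeq_def)
  then have "valid (rev xs)" by (rule snoc.IH)
  moreover have "?ok x (length xs)" using ok[of "length xs"] n by simp
  ultimately show ?case by (cases x) auto
qed simp

lemma uv_rev_permutes:
  "valid xs \<Longrightarrow> fst (uv_rev xs) permutes {1..length xs} \<and> snd (uv_rev xs) permutes {1..length xs}"
proof (induction xs rule: valid.induct)
  case 1 then show ?case by (simp add: id_def)
next
  case (2 j xs) then show ?case using eps_permutes[of _ "length xs" j] by (simp add: case_prod_beta)
next
  case (3 j xs)
  then show ?case using eps_permutes[of _ "length xs" j] eps_permutes[of _ "length xs" "Suc j"]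
    by (simp add: case_prod_beta)
qed

lemma rich_0:
  assumes "U \<in> GLn 0" "V \<in> GLn 0"
  shows "rich 0 U V = GLn 0"
proof -
  have "X \<in> setmul3 0 P W (Bup 0)" if X: "X \<in> GLn 0" and P: "idm 0 \<in> P" for X P W
  proof -
    have "X = mmul 0 (mmul 0 (idm 0) W) (idm 0)"
      by (rule mats_eqI[of _ 0]) (use X in \<open>auto simp: GLn_mats\<close>)
    then show ?thesis using P idm_Bup unfolding setmul3_def by blast
  qed
  moreover have "idm 0 \<in> Blow 0" by (simp add: Blow_iff idm_def mats_def)
  ultimately have "GLn 0 \<subseteq> closure (setmul3 0 (Bup 0) V (Bup 0))"
    "GLn 0 \<subseteq> closure (setmul3 0 (Blow 0) U (Bup 0))"
    using idm_Bup closure_subset by blast+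
  then show ?thesis by (auto simp: rich_def)
qed

lemma Xr_Nil: "Xr [] = GLn 0"
proof -
  have "pmat 0 id \<in> GLn 0" by (rule pmat_GLn) (simp add: permutes_id)
  then show ?thesis by (simp add: Xr_def Richardson_eq_rich rich_0)
qed

lemma Xr_R:
  assumes "valid (R j # xs)"
  shows "Xr (R j # xs) = attach_R (length xs) (j - 1) (Xr xs)"
proof -
  obtain i where j: "j = Suc i" "i \<le> length xs" using assms by (cases j) auto
  have "fst (uv_rev xs) permutes {1..length xs}" "snd (uv_rev xs) permutes {1..length xs}"
    using assms uv_rev_permutes by auto
  then show ?thesis using j
    by (simp add: Xr_def Richardson_eq_rich case_prod_beta pmat_eps rich_attach_R)
qed

lemma Xr_T:
  assumes "valid (T j # xs)"
  shows "Xr (T j # xs) = attach_T (length xs) (j - 1) (Xr xs)"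
proof -
  obtain i where j: "j = Suc i" "Suc i \<le> length xs" using assms by (cases j) auto
  have "fst (uv_rev xs) permutes {1..length xs}" "snd (uv_rev xs) permutes {1..length xs}"
    using assms uv_rev_permutes by auto
  then show ?thesis using j
    by (simp add: Xr_def Richardson_eq_rich case_prod_beta pmat_eps rich_attach_T pmat_GLn)
qed

lemma attach_R_GLn:
  assumes "j \<le> n" "S \<subseteq> GLn n"
  shows "attach_R n j S \<subseteq> GLn (Suc n)"
proof
  fix X assume "X \<in> attach_R n j S"
  then obtain A b where A: "A \<in> S" "b \<in> Bup (Suc n)" "X = mmul (Suc n) (ins 0 j A) b"
    unfolding attach_R_def by blast
  have "A \<in> GLn n" using A assms by blast
  then have "ins 0 j A \<in> GLn (Suc n)" using ins_GLn_iff assms GLn_mats by blast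
  then show "X \<in> GLn (Suc n)" using A GLn_mmul Bup_GLn by blast
qed

lemma attach_T_open_GLn:
  assumes "Suc j \<le> n" "S \<subseteq> GLn n"
  shows "attach_T_open n j S \<subseteq> GLn (Suc n)"
proof
  have j: "Suc j < Suc n" "j \<le> n" using assms by auto
  fix X assume "X \<in> attach_T_open n j S"
  then obtain A \<alpha> \<beta> \<gamma> \<delta> b where A: "A \<in> S" and D: "\<alpha> * \<delta> - \<beta> * \<gamma> \<noteq> 0" and b: "b \<in> Bup (Suc n)"
    and X: "X = mmul (Suc n) (mmul (Suc n) (ins 0 j A) (blk (Suc n) j \<alpha> \<beta> \<gamma> \<delta>)) b"
    unfolding attach_T_open_def by blast
  have "A \<in> GLn n" using A assms by blast
  then have "ins 0 j A \<in> GLn (Suc n)" using ins_GLn_iff j GLn_mats by blast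
  then show "X \<in> GLn (Suc n)" unfolding X
    by (intro GLn_mmul[OF GLn_mmul] blk_GLn[OF D j(1)] Bup_GLn[OF b])
qed

lemma cell_GLn: "valid xs \<Longrightarrow> cell xs \<subseteq> GLn (length xs)"
proof (induction xs rule: valid.induct)
  case (2 j xs)
  then have "attach_R (length xs) (j - 1) (cell xs) \<subseteq> GLn (Suc (length xs))"
    by (intro attach_R_GLn) auto
  then show ?case by simp
next
  case (3 j xs)
  then have "attach_T_open (length xs) (j - 1) (cell xs) \<subseteq> GLn (Suc (length xs))"
    by (intro attach_T_open_GLn) auto
  then show ?case by simp
qed simp

lemma cell_nonempty: "cell xs \<noteq> {}"
proof (induction xs rule: cell.induct)
  case 1 show ?case using idm_Bup Bup_GLn by auto
next
  case (2 j xs) then show ?case using idm_Bup by (auto simp: attach_R_def)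
next
  case (3 j xs)
  then obtain A where "A \<in> cell xs" by blast
  \<comment> \<open>The block with \<alpha> = \<beta> = \<delta> = 1 and \<gamma> = 0: generic first
    column, determinant 1.\<close>
  moreover have "1 * 1 - 1 * 0 \<noteq> (0::complex)" "1 \<noteq> (0::complex)" by simp_all
  ultimately have "mmul (Suc (length xs)) (mmul (Suc (length xs)) (ins 0 (j - 1) A)
      (blk (Suc (length xs)) (j - 1) 1 1 0 1)) (idm (Suc (length xs))) \<in> cell (T j # xs)"
    using idm_Bup[of "Suc (length xs)"] unfolding cell.simps attach_T_open_def by blast
  then show ?case by blast
qed

lemma attach_R_UN: "attach_R n j (\<Union>i\<in>I. S i) = (\<Union>i\<in>I. attach_R n j (S i))"
  by (auto simp: attach_R_def)

lemma attach_T_open_UN: "attach_T_open n j (\<Union>i\<in>I. S i) = (\<Union>i\<in>I. attach_T_open n j (S i))"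
proof (intro equalityI subsetI)
  fix X assume "X \<in> attach_T_open n j (\<Union>i\<in>I. S i)"
  then obtain A \<alpha> \<beta> \<gamma> \<delta> b i where i: "i \<in> I" and A: "A \<in> S i" "\<alpha> \<noteq> 0" "\<beta> \<noteq> 0" "\<alpha> * \<delta> - \<beta> * \<gamma> \<noteq> 0"
    "b \<in> Bup (Suc n)" "X = mmul (Suc n) (mmul (Suc n) (ins 0 j A) (blk (Suc n) j \<alpha> \<beta> \<gamma> \<delta>)) b"
    unfolding attach_T_open_def by blast
  then have "X \<in> attach_T_open n j (S i)" unfolding attach_T_open_def by blast
  then show "X \<in> (\<Union>i\<in>I. attach_T_open n j (S i))" using i by blast
next
  fix X assume "X \<in> (\<Union>i\<in>I. attach_T_open n j (S i))"
  then obtain i where "i \<in> I" "X \<in> attach_T_open n j (S i)" by blast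
  moreover from this obtain A \<alpha> \<beta> \<gamma> \<delta> b where "A \<in> S i" "\<alpha> \<noteq> 0" "\<beta> \<noteq> 0" "\<alpha> * \<delta> - \<beta> * \<gamma> \<noteq> 0"
    "b \<in> Bup (Suc n)" "X = mmul (Suc n) (mmul (Suc n) (ins 0 j A) (blk (Suc n) j \<alpha> \<beta> \<gamma> \<delta>)) b"
    unfolding attach_T_open_def by blast
  ultimately show "X \<in> attach_T_open n j (\<Union>i\<in>I. S i)" unfolding attach_T_open_def by blast
qed

section \<open>Resolutions and the decomposition into cells\<close>

definition resolves :: "letter \<Rightarrow> letter \<Rightarrow> bool" where
  "resolves y x \<longleftrightarrow> y = x \<or> (\<exists>i. x = T i \<and> (y = R i \<or> y = R (Suc i)))"

lemma resolutions_eq: "resolutions \<Omega> = {\<Omega>'. list_all2 resolves \<Omega>' \<Omega>}"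
  by (auto simp: resolutions_def list_all2_conv_all_nth resolves_def)

text \<open>A letter \<open>R\<close> resolves only to itself, so at most one of the two steps
  changes the letter.\<close>

lemma resolves_trans: "resolves z y \<Longrightarrow> resolves y x \<Longrightarrow> resolves z x"
  by (auto simp: resolves_def)

text \<open>The bound for \<open>R\<close> exceeds that for \<open>T\<close> by one, which leaves
  room for the index \<open>Suc i\<close>.\<close>

lemma resolves_valid: "list_all2 resolves ys xs \<Longrightarrow> valid xs \<Longrightarrow> valid ys"
proof (induction rule: list_all2_induct)
  case (Cons y ys x xs)
  then have "length ys = length xs" by (simp add: list_all2_lengthD)
  then show ?case using Cons by (cases x) (auto simp: resolves_def)
qed simp

text \<open>Attaching a letter commutes with unions. A \<open>T\<close> contributes the open part
  and two fixed points over each flag, and these pieces match its three resolutions,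
  \<open>T\<close> itself included.\<close>

lemma Xr_eq_UN_cell: "valid xs \<Longrightarrow> Xr xs = (\<Union>ys\<in>{ys. list_all2 resolves ys xs}. cell ys)"
proof (induction xs rule: valid.induct)
  case 1 show ?case by (simp add: Xr_Nil)
next
  case (2 j xs)
  let ?I = "{ys. list_all2 resolves ys xs}"
  have I: "{ys. list_all2 resolves ys (R j # xs)} = (#) (R j) ` ?I"
    by (auto simp: list_all2_Cons2 resolves_def)
  have "Xr (R j # xs) = attach_R (length xs) (j - 1) (\<Union>ys\<in>?I. cell ys)"
    using 2 by (simp add: Xr_R)
  also have "\<dots> = (\<Union>ys\<in>?I. cell (R j # ys))"
    unfolding attach_R_UN by (intro SUP_cong refl) (auto dest: list_all2_lengthD)
  finally show ?case unfolding I by simp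
next
  case (3 j xs)
  let ?I = "{ys. list_all2 resolves ys xs}" and ?n = "length xs"
  have I: "{ys. list_all2 resolves ys (T j # xs)} =
      (#) (T j) ` ?I \<union> (#) (R j) ` ?I \<union> (#) (R (Suc j)) ` ?I"
    by (auto simp: list_all2_Cons2 resolves_def)
  have j: "Suc (j - 1) = j" "Suc (j - 1) \<le> ?n" using 3 by auto
  have "Xr xs \<subseteq> mats ?n" by (auto simp: Xr_def Richardson_eq_rich rich_def GLn_def)
  then have "Xr (T j # xs) = attach_T_open ?n (j - 1) (Xr xs) \<union> attach_R ?n (j - 1) (Xr xs) \<union>
      attach_R ?n j (Xr xs)"
    using 3 attach_T_decomp[OF j(2)] j(1) by (simp add: Xr_T)
  also have "\<dots> = (\<Union>ys\<in>?I. cell (T j # ys)) \<union> (\<Union>ys\<in>?I. cell (R j # ys)) \<union>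
      (\<Union>ys\<in>?I. cell (R (Suc j) # ys))"
  proof -
    have "Xr xs = (\<Union>ys\<in>?I. cell ys)" using 3 by simp
    then show ?thesis
      by (simp only: attach_R_UN attach_T_open_UN)
        (intro arg_cong2[of _ _ _ _ "(\<union>)"] SUP_cong refl; auto dest: list_all2_lengthD)
  qed
  finally show ?case unfolding I UN_Un image_image[symmetric] by simp
qed

section \<open>Each cell is one torus orbit\<close>

lemma cell_torus_stable:
  assumes "valid xs" "X \<in> cell xs" "t \<in> Torus (length xs)" "b \<in> Bup (length xs)"
  shows "mmul (length xs) (mmul (length xs) t X) b \<in> cell xs"
  using assms
proof (induction xs arbitrary: X t b rule: valid.induct)
  case 1
  then show ?case by (auto intro!: GLn_mmul simp: Torus_def Bup_def)
next
  case (2 j xs)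
  let ?n = "length xs" and ?N = "Suc (length xs)"
  obtain A c where A: "A \<in> cell xs" "c \<in> Bup ?N" and X: "X = mmul ?N (ins 0 (j - 1) A) c"
    using 2 by (auto simp: attach_R_def)
  have j: "j - 1 \<le> ?n" and t: "t \<in> Torus ?N" and b: "b \<in> Bup ?N" using 2 by auto
  let ?A = "mmul ?n (del 0 0 t) A"
  have t': "del 0 0 t \<in> Torus ?n" using t by (simp add: del_Torus)
  have "mmul ?n ?A (idm ?n) \<in> cell xs" using 2 by (intro "2.IH" A t' idm_Bup) auto
  then have A': "?A \<in> cell xs" by simp
  \<comment> \<open>\<open>t\<close> passes through \<open>ins\<close>: its remaining coordinates
    act on \<open>A\<close>, and the first one ends in the upper triangular factor.\<close>
  have "mmul ?N (mmul ?N t X) b =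
      mmul ?N (ins 0 (j - 1) ?A) (mmul ?N (mmul ?N (dg ?N (j - 1) (t 0 0)) c) b)"
    unfolding X mmul_assoc[symmetric] Torus_mmul_ins[OF t j] ..
  moreover have "mmul ?N (mmul ?N (dg ?N (j - 1) (t 0 0)) c) b \<in> Bup ?N"
    using t by (intro Bup_mmul Torus_Bup dg_Torus A b) (auto simp: Torus_iff)
  ultimately show ?case using A' by (auto simp: attach_R_def)
next
  case (3 j xs)
  let ?n = "length xs" and ?N = "Suc (length xs)" and ?j = "j - 1"
  obtain A c \<alpha> \<beta> \<gamma> \<delta> where A: "A \<in> cell xs" "c \<in> Bup ?N" "\<alpha> \<noteq> 0" "\<beta> \<noteq> 0" "\<alpha> * \<delta> - \<beta> * \<gamma> \<noteq> 0"
    and X: "X = mmul ?N (mmul ?N (ins 0 ?j A) (blk ?N ?j \<alpha> \<beta> \<gamma> \<delta>)) c"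
    using 3(3) unfolding cell.simps attach_T_open_def by blast
  have j: "?j \<le> ?n" and t: "t \<in> Torus ?N" and b: "b \<in> Bup ?N" using 3 by auto
  let ?A = "mmul ?n (del 0 0 t) A" and ?s = "t 0 0"
  have s: "?s \<noteq> 0" using t by (simp add: Torus_iff)
  have t': "del 0 0 t \<in> Torus ?n" using t by (simp add: del_Torus)
  have "mmul ?n ?A (idm ?n) \<in> cell xs" using 3 by (intro "3.IH" A t' idm_Bup) auto
  then have A': "?A \<in> cell xs" by simp
  have "mmul ?N (mmul ?N t X) b = mmul ?N (mmul ?N (mmul ?N t (ins 0 ?j A)) (blk ?N ?j \<alpha> \<beta> \<gamma> \<delta>)) (mmul ?N c b)"
    unfolding X mmul_assoc ..
  also have "\<dots> = mmul ?N (mmul ?N (ins 0 ?j ?A) (mmul ?N (dg ?N ?j ?s) (blk ?N ?j \<alpha> \<beta> \<gamma> \<delta>))) (mmul ?N c b)"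
    unfolding Torus_mmul_ins[OF t j] mmul_assoc ..
  also have "\<dots> = mmul ?N (mmul ?N (ins 0 ?j ?A) (blk ?N ?j (?s * \<alpha>) \<beta> (?s * \<gamma>) \<delta>)) (mmul ?N c b)"
    unfolding dg_mmul_blk[OF s] ..
  finally have eq: "mmul ?N (mmul ?N t X) b =
    mmul ?N (mmul ?N (ins 0 ?j ?A) (blk ?N ?j (?s * \<alpha>) \<beta> (?s * \<gamma>) \<delta>)) (mmul ?N c b)" .
  \<comment> \<open>Scaling the first row of the block keeps its first column generic and multiplies
    the determinant by \<open>?s\<close>.\<close>
  have "?s * \<alpha> * \<delta> - \<beta> * (?s * \<gamma>) = ?s * (\<alpha> * \<delta> - \<beta> * \<gamma>)" by (simp add: algebra_simps)
  then have "?s * \<alpha> * \<delta> - \<beta> * (?s * \<gamma>) \<noteq> 0" "?s * \<alpha> \<noteq> 0" using s A by auto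
  moreover have "mmul ?N c b \<in> Bup ?N" by (intro Bup_mmul A b)
  ultimately have "mmul ?N (mmul ?N t X) b \<in> attach_T_open ?n ?j (cell xs)"
    using A' A(4) eq unfolding attach_T_open_def by blast
  then show ?case by simp
qed

text \<open>Row scaling absorbs the difference between two generic choices of the \<open>2 \<times> 2\<close> block.\<close>
lemma blk_torus_transfer:
  assumes j: "Suc j < n" and q: "q \<in> pshape n j" "q \<in> GLn n" "q j j \<noteq> 0" "q (Suc j) j \<noteq> 0"
    and g: "\<alpha> \<noteq> 0" "\<beta> \<noteq> 0" "\<alpha> * \<delta> - \<beta> * \<gamma> \<noteq> 0"
  obtains s b where "s \<noteq> 0" "b \<in> Bup n" "q = mmul n (dg n j s) (mmul n (blk n j \<alpha> \<beta> \<gamma> \<delta>) b)"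
proof -
  obtain x y z w where D: "x * w - y * z \<noteq> 0"
    and inv1: "mmul n (blk n j \<alpha> \<beta> \<gamma> \<delta>) (blk n j x y z w) = idm n"
    and inv2: "mmul n (blk n j x y z w) (blk n j \<alpha> \<beta> \<gamma> \<delta>) = idm n"
    using blk_inverse[OF g(3) j] by metis
  \<comment> \<open>The second row of the inverse block annihilates (\<alpha>, \<beta>).\<close>
  have "mmul n (blk n j x y z w) (blk n j \<alpha> \<beta> \<gamma> \<delta>) (Suc j) j = 0"
    unfolding inv2 by (simp add: idm_def)
  then have rel: "y * \<alpha> + w * \<beta> = 0"
    using j by (subst (asm) blk_mmul_row) (simp_all add: blk_def)
  \<comment> \<open>Chosen so that scaling row \<open>j\<close> by \<open>inverse s\<close> makes
    the entries of column \<open>j\<close> of \<open>q\<close> in the rows \<open>j\<close> and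
    \<open>j + 1\<close> proportional to (\<alpha>, \<beta>); the inverse block then clears the
    entry \<open>(j + 1, j)\<close>.\<close>
  define s where "s = \<beta> * q j j / (\<alpha> * q (Suc j) j)"
  have s: "s \<noteq> 0" "inverse s \<noteq> 0" using q g by (auto simp: s_def)
  let ?Z = "mmul n (dg n j (inverse s)) q"
  have Z: "?Z i k = (if i = j then inverse s * q i k else q i k)" if "i < n" "k < n" for i k
    unfolding mmul_Torus_left[OF dg_Torus[OF s(2)] that] using that by (simp add: dg_def)
  let ?b = "mmul n (blk n j x y z w) ?Z"
  have "?b (Suc j) j = y * (inverse s * q j j) + w * q (Suc j) j"
    using j by (subst blk_mmul_row) (simp_all add: Z)
  also have "inverse s * q j j = \<alpha> * q (Suc j) j / \<beta>" using q g by (simp add: s_def)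
  also have "y * (\<alpha> * q (Suc j) j / \<beta>) + w * q (Suc j) j = (y * \<alpha> + w * \<beta>) * q (Suc j) j / \<beta>"
    using g by (simp add: field_simps)
  finally have b0: "?b (Suc j) j = 0" using rel by simp
  have dB: "dg n j (inverse s) \<in> Bup n" by (intro Torus_Bup dg_Torus s)
  have "?b \<in> pshape n j"
    by (rule pshape_mmul[OF blk_pshape pshape_mmul[OF Bup_pshape[OF dB] q(1)]])
  then have "?b \<in> upper n" using b0 upper_pshape_iff by blast
  moreover have "?b \<in> GLn n"
    by (rule GLn_mmul[OF blk_GLn[OF D j] GLn_mmul[OF Bup_GLn[OF dB] q(2)]])
  ultimately have b: "?b \<in> Bup n" by (simp add: Bup_def upper_def)
  have "mmul n (dg n j s) (mmul n (blk n j \<alpha> \<beta> \<gamma> \<delta>) ?b) =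
      mmul n (mmul n (dg n j s) (mmul n (mmul n (blk n j \<alpha> \<beta> \<gamma> \<delta>) (blk n j x y z w)) (dg n j (inverse s)))) q"
    unfolding mmul_assoc ..
  also have "\<dots> = q"
    using s dB q(2) by (simp add: inv1 Bup_mats GLn_mats dg_mmul_dg)
  finally show thesis using that[OF s(1) b] by simp
qed

lemma cell_single_orbit:
  assumes "valid xs" "X \<in> cell xs" "Y \<in> cell xs"
  shows "Y \<in> setmul3 (length xs) (Torus (length xs)) X (Bup (length xs))"
  using assms
proof (induction xs arbitrary: X Y rule: valid.induct)
  case 1
  have "Y = mmul 0 (mmul 0 (idm 0) X) (idm 0)"
    by (rule mats_eqI[of _ 0]) (use 1 in \<open>auto simp: GLn_mats\<close>)
  then show ?case using idm_Torus idm_Bup unfolding setmul3_def list.size by blast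
next
  case (2 j xs)
  let ?n = "length xs" and ?N = "Suc (length xs)" and ?j = "j - 1"
  have j: "?j \<le> ?n" using 2 by auto
  obtain A b where A: "A \<in> cell xs" "b \<in> Bup ?N" and X: "X = mmul ?N (ins 0 ?j A) b"
    using 2 by (auto simp: attach_R_def)
  obtain A' b' where A': "A' \<in> cell xs" "b' \<in> Bup ?N" and Y: "Y = mmul ?N (ins 0 ?j A') b'"
    using 2 by (auto simp: attach_R_def)
  have "A' \<in> setmul3 ?n (Torus ?n) A (Bup ?n)" using 2 A A' by auto
  then obtain t c where tc: "t \<in> Torus ?n" "c \<in> Bup ?n" "A' = mmul ?n (mmul ?n t A) c"
    by (auto simp: setmul3_def)
  have insA': "ins 0 ?j A' = mmul ?N (mmul ?N (ins 0 0 t) (ins 0 ?j A)) (ins ?j ?j c)"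
    using j by (simp add: tc mmul_ins)
  obtain d where d: "d \<in> Bup ?N" "mmul ?N b d = idm ?N" using Bup_inverse[OF A(2)] by blast
  have insA: "ins 0 ?j A \<in> mats ?N"
    using A j cell_GLn[of xs] 2 by (intro ins_mats) (auto simp: GLn_def)
  \<comment> \<open>Inserting \<open>b d = 1\<close> makes \<open>X\<close> reappear inside
    \<open>Y\<close>.\<close>
  have "Y = mmul ?N (mmul ?N (ins 0 0 t) (mmul ?N (ins 0 ?j A) (mmul ?N b d))) (mmul ?N (ins ?j ?j c) b')"
    unfolding Y insA' d(2) using insA by (simp add: mmul_assoc)
  also have "\<dots> = mmul ?N (mmul ?N (ins 0 0 t) X) (mmul ?N d (mmul ?N (ins ?j ?j c) b'))"
    unfolding X mmul_assoc ..
  finally have "Y = mmul ?N (mmul ?N (ins 0 0 t) X) (mmul ?N d (mmul ?N (ins ?j ?j c) b'))" .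
  moreover have "ins 0 0 t \<in> Torus ?N" using tc by (simp add: ins_Torus)
  moreover have "mmul ?N d (mmul ?N (ins ?j ?j c) b') \<in> Bup ?N" by (intro Bup_mmul d ins_Bup tc j A')
  ultimately have "Y \<in> setmul3 ?N (Torus ?N) X (Bup ?N)" unfolding setmul3_def by blast
  then show ?case by simp
next
  case (3 j xs)
  let ?n = "length xs" and ?N = "Suc (length xs)" and ?j = "j - 1"
  have j: "?j \<le> ?n" "Suc ?j < ?N" using 3 by auto
  obtain A b \<alpha> \<beta> \<gamma> \<delta> where A: "A \<in> cell xs" "b \<in> Bup ?N" and g: "\<alpha> \<noteq> 0" "\<beta> \<noteq> 0" "\<alpha> * \<delta> - \<beta> * \<gamma> \<noteq> 0"
    and X: "X = mmul ?N (mmul ?N (ins 0 ?j A) (blk ?N ?j \<alpha> \<beta> \<gamma> \<delta>)) b"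
    using 3(3) unfolding cell.simps attach_T_open_def by blast
  obtain A' b' \<alpha>' \<beta>' \<gamma>' \<delta>' where A': "A' \<in> cell xs" "b' \<in> Bup ?N"
    and g': "\<alpha>' \<noteq> 0" "\<beta>' \<noteq> 0" "\<alpha>' * \<delta>' - \<beta>' * \<gamma>' \<noteq> 0"
    and Y: "Y = mmul ?N (mmul ?N (ins 0 ?j A') (blk ?N ?j \<alpha>' \<beta>' \<gamma>' \<delta>')) b'"
    using 3(4) unfolding cell.simps attach_T_open_def by blast
  let ?g = "blk ?N ?j \<alpha> \<beta> \<gamma> \<delta>" and ?g' = "blk ?N ?j \<alpha>' \<beta>' \<gamma>' \<delta>'"
  have "A' \<in> setmul3 ?n (Torus ?n) A (Bup ?n)" using 3 A A' by auto
  then obtain t c where tc: "t \<in> Torus ?n" "c \<in> Bup ?n" "A' = mmul ?n (mmul ?n t A) c"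
    by (auto simp: setmul3_def)
  have insA': "ins 0 ?j A' = mmul ?N (mmul ?N (ins 0 0 t) (ins 0 ?j A)) (ins ?j ?j c)"
    using j by (simp add: tc mmul_ins)
  have Am: "A \<in> mats ?n" using A cell_GLn[of xs] 3 by (auto simp: GLn_def)
  have c': "ins ?j ?j c \<in> Bup ?N" by (intro ins_Bup j tc)
  \<comment> \<open>The factor \<open>c\<close> sits between \<open>A\<close> and the block of
    \<open>Y\<close>, so both are merged into one parabolic matrix and compared with the block of
    \<open>X\<close>. The zeros beside the pivot of the inserted \<open>c\<close> keep column
    \<open>j\<close> generic.\<close>
  let ?q = "mmul ?N (ins ?j ?j c) ?g'"
  have q: "?q \<in> pshape ?N ?j" "?q \<in> GLn ?N"
    by (intro pshape_mmul Bup_pshape c' blk_pshape) (rule GLn_mmul[OF Bup_GLn[OF c'] blk_GLn[OF g'(3) j(2)]])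
  have jN: "?j < ?N" using j by simp
  have "ins ?j ?j c (Suc ?j) ?j = 0" "ins ?j ?j c ?j (Suc ?j) = 0" by (auto simp: ins_def)
  moreover have "ins ?j ?j c (Suc ?j) (Suc ?j) \<noteq> 0" using c' j by (auto simp: Bup_iff)
  ultimately have "?q ?j ?j \<noteq> 0" "?q (Suc ?j) ?j \<noteq> 0"
    unfolding mmul_blk[OF jN jN j(2)] mmul_blk[OF j(2) jN j(2)] using g' by simp_all
  then obtain s e where s: "s \<noteq> 0" and e: "e \<in> Bup ?N" and qe: "?q = mmul ?N (dg ?N ?j s) (mmul ?N ?g e)"
    using blk_torus_transfer[OF j(2) q _ _ g] by blast
  obtain d where d: "d \<in> Bup ?N" "mmul ?N b d = idm ?N" using Bup_inverse[OF A(2)] by blast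
  have sT: "dg ?N 0 s \<in> Torus ?N" by (rule dg_Torus[OF s])
  \<comment> \<open>A torus matrix that differs from the identity only in its first entry passes
    through \<open>ins\<close> as a scaling of column \<open>j\<close> alone.\<close>
  have "del 0 0 (dg ?N 0 s) = idm ?n" by (intro ext) (auto simp: del_def dg_def idm_def)
  then have sins: "mmul ?N (ins 0 ?j A) (dg ?N ?j s) = mmul ?N (dg ?N 0 s) (ins 0 ?j A)"
    using Torus_mmul_ins[OF sT j(1), of A] Am by (simp add: dg_def[of _ 0])
  have "Y = mmul ?N (ins 0 0 t) (mmul ?N (ins 0 ?j A) (mmul ?N ?q b'))"
    unfolding Y insA' mmul_assoc ..
  also have "\<dots> = mmul ?N (ins 0 0 t) (mmul ?N (mmul ?N (ins 0 ?j A) (dg ?N ?j s)) (mmul ?N ?g (mmul ?N e b')))"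
    unfolding qe mmul_assoc ..
  also have "\<dots> = mmul ?N (ins 0 0 t) (mmul ?N (dg ?N 0 s) (mmul ?N (ins 0 ?j A) (mmul ?N (mmul ?N ?g (mmul ?N b d)) (mmul ?N e b'))))"
    unfolding sins d(2) mmul_idm_right[OF blk_mats] mmul_assoc ..
  also have "\<dots> = mmul ?N (mmul ?N (mmul ?N (ins 0 0 t) (dg ?N 0 s)) X) (mmul ?N d (mmul ?N e b'))"
    unfolding X mmul_assoc ..
  finally have "Y = mmul ?N (mmul ?N (mmul ?N (ins 0 0 t) (dg ?N 0 s)) X) (mmul ?N d (mmul ?N e b'))" .
  moreover have "mmul ?N (ins 0 0 t) (dg ?N 0 s) \<in> Torus ?N"
    using tc by (intro Torus_mmul sT ins_Torus) auto
  moreover have "mmul ?N d (mmul ?N e b') \<in> Bup ?N" by (intro Bup_mmul d e A')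
  ultimately have "Y \<in> setmul3 ?N (Torus ?N) X (Bup ?N)" unfolding setmul3_def by blast
  then show ?case by simp
qed

lemma cell_eq_orbit:
  assumes "valid xs" "g \<in> cell xs"
  shows "setmul3 (length xs) (Torus (length xs)) g (Bup (length xs)) = cell xs"
proof (intro equalityI subsetI)
  fix Y assume "Y \<in> setmul3 (length xs) (Torus (length xs)) g (Bup (length xs))"
  then show "Y \<in> cell xs" using cell_torus_stable[OF assms] unfolding setmul3_def by blast
qed (rule cell_single_orbit[OF assms])

section \<open>Closures of the cells\<close>

lemma attach_R_closure:
  assumes "S \<subseteq> closure U"
  shows "attach_R n j S \<subseteq> closure (attach_R n j U)"
proof
  fix X assume "X \<in> attach_R n j S"
  then obtain A b where A: "A \<in> closure U" "b \<in> Bup (Suc n)" and X: "X = mmul (Suc n) (ins 0 j A) b"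
    using assms by (auto simp: attach_R_def)
  show "X \<in> closure (attach_R n j U)" unfolding X
  proof (rule closure_map[OF _ A(1)])
    show "continuous_on UNIV (\<lambda>A. mmul (Suc n) (ins 0 j A) b)"
      by (rule continuous_on_mmul, rule continuous_on_ins, rule continuous_on_id, rule continuous_on_const)
    show "mmul (Suc n) (ins 0 j B) b \<in> closure (attach_R n j U)" if "B \<in> U" for B
      using that A(2) closure_subset[of "attach_R n j U"] by (auto simp: attach_R_def)
  qed
qed

text \<open>The open part needs \<alpha> and \<beta> nonzero. A vanishing one is moved off 0, and
  the determinant stays nonzero nearby because that condition is open.\<close>

lemma attach_T_closure:
  assumes "S \<subseteq> closure U"
  shows "attach_T n j S \<subseteq> closure (attach_T_open n j U)" (is "_ \<subseteq> ?K")
proof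
  let ?N = "Suc n"
  fix X assume "X \<in> attach_T n j S"
  then obtain A \<alpha> \<beta> \<gamma> \<delta> b where A: "A \<in> closure U" and D: "\<alpha> * \<delta> - \<beta> * \<gamma> \<noteq> 0" and b: "b \<in> Bup ?N"
    and X: "X = mmul ?N (mmul ?N (ins 0 j A) (blk ?N j \<alpha> \<beta> \<gamma> \<delta>)) b"
    using assms unfolding attach_T_def by blast
  let ?f = "\<lambda>B x y. mmul ?N (mmul ?N (ins 0 j B) (blk ?N j x y \<gamma> \<delta>)) b"
  have generic: "?f B x y \<in> ?K" if "B \<in> U" "x \<noteq> 0" "y \<noteq> 0" "x * \<delta> - y * \<gamma> \<noteq> 0" for B x y
  proof -
    have "?f B x y \<in> attach_T_open n j U" using that b unfolding attach_T_open_def by blast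
    then show ?thesis using closure_subset by blast
  qed
  have cont: "continuous_on UNIV (\<lambda>z. ?f B (p z) (q z))"
    if "continuous_on UNIV p" "continuous_on UNIV q" for B and p q :: "complex \<Rightarrow> complex"
    by (rule continuous_on_mmul, rule continuous_on_mmul, rule continuous_on_const,
        rule continuous_on_blk, rule that, rule that, rule continuous_on_const)
  have ev: "\<forall>\<^sub>F z in at a. h z \<noteq> 0" if "continuous_on UNIV h" "h a \<noteq> 0" for h :: "complex \<Rightarrow> complex" and a
  proof (rule tendsto_imp_eventually_ne)
    show "(h \<longlongrightarrow> h a) (at a)" using that(1) by (simp add: continuous_on_def)
  qed fact
  show "X \<in> ?K" unfolding X
  proof (rule closure_map[OF _ A])
    show "continuous_on UNIV (\<lambda>A. ?f A \<alpha> \<beta>)"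
      by (rule continuous_on_mmul, rule continuous_on_mmul, rule continuous_on_ins,
          rule continuous_on_id, rule continuous_on_const, rule continuous_on_const)
    fix B assume B: "B \<in> U"
    \<comment> \<open>A nonzero determinant rules out \<alpha> = \<beta> = 0, so only one parameter
      has to move.\<close>
    consider "\<alpha> \<noteq> 0" "\<beta> \<noteq> 0" | "\<alpha> = 0" "\<beta> \<noteq> 0" | "\<beta> = 0" "\<alpha> \<noteq> 0" using D by fastforce
    then show "?f B \<alpha> \<beta> \<in> ?K"
    proof cases
      case 1 then show ?thesis using generic B D by blast
    next
      case 2
      show ?thesis
      proof (rule limit_in_closed[of "\<lambda>z. ?f B z \<beta>"])
        have "\<forall>\<^sub>F z in at \<alpha>. z * \<delta> - \<beta> * \<gamma> \<noteq> 0"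
          by (rule ev) (intro continuous_intros, rule D)
        moreover have "\<forall>\<^sub>F z in at \<alpha>. z \<noteq> 0" unfolding 2(1) by (rule eventually_neq_at_within)
        ultimately show "\<forall>\<^sub>F z in at \<alpha>. ?f B z \<beta> \<in> ?K"
          by eventually_elim (rule generic[OF B _ 2(2)])
      qed (rule cont, rule continuous_on_id, rule continuous_on_const, rule closed_closure)
    next
      case 3
      show ?thesis
      proof (rule limit_in_closed[of "\<lambda>z. ?f B \<alpha> z"])
        have "\<forall>\<^sub>F z in at \<beta>. \<alpha> * \<delta> - z * \<gamma> \<noteq> 0"
          by (rule ev) (intro continuous_intros, rule D)
        moreover have "\<forall>\<^sub>F z in at \<beta>. z \<noteq> 0" unfolding 3(1) by (rule eventually_neq_at_within)
        ultimately show "\<forall>\<^sub>F z in at \<beta>. ?f B \<alpha> z \<in> ?K"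
          by eventually_elim (rule generic[OF B 3(2)])
      qed (rule cont, rule continuous_on_const, rule continuous_on_id, rule closed_closure)
    qed
  qed
qed

lemma Xr_subset_closure_cell: "valid xs \<Longrightarrow> Xr xs \<subseteq> closure (cell xs)"
proof (induction xs rule: valid.induct)
  case 1 show ?case using closure_subset by (auto simp: Xr_Nil)
next
  case (2 j xs) then show ?case by (auto simp: Xr_R dest: subsetD[OF attach_R_closure])
next
  case (3 j xs) then show ?case by (auto simp: Xr_T dest: subsetD[OF attach_T_closure])
qed

text \<open>\<open>Xr xs\<close> is the part in \<open>GLn\<close> of a closed set containing the
  cell, which gives one inclusion; density of the cell gives the other.\<close>

lemma Xr_eq_closure_cell:
  assumes "valid xs"
  shows "Xr xs = GLn (length xs) \<inter> closure (cell xs)"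
proof -
  let ?C = "\<lambda>P w. closure (setmul3 (length xs) P w (Bup (length xs)))"
  have X: "Xr xs = GLn (length xs) \<inter> (?C (Bup (length xs)) (pmat (length xs) (snd (uv_rev xs))) \<inter>
      ?C (Blow (length xs)) (pmat (length xs) (fst (uv_rev xs))))" (is "_ = _ \<inter> ?D")
    by (auto simp: Xr_def Richardson_eq_rich rich_def)
  have "list_all2 resolves xs xs" by (simp add: list_all2_refl resolves_def)
  then have "cell xs \<subseteq> Xr xs" using Xr_eq_UN_cell[OF assms] by blast
  then have "closure (cell xs) \<subseteq> ?D" unfolding X by (intro closure_minimal) auto
  then show ?thesis using Xr_subset_closure_cell[OF assms] X by blast
qed

lemma torus_orbit_closure_cell:
  assumes "valid xs" "g \<in> cell xs"
  shows "torus_orbit_closure (length xs) g = Xr xs"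
  unfolding torus_orbit_closure_def cell_eq_orbit[OF assms] Xr_eq_closure_cell[OF assms(1)] ..

lemma mem_torus_orbit_closure:
  assumes "g \<in> GLn n"
  shows "g \<in> torus_orbit_closure n g"
proof -
  have "g = mmul n (mmul n (idm n) g) (idm n)" using assms by (simp add: GLn_mats)
  then have "g \<in> setmul3 n (Torus n) g (Bup n)"
    using idm_Torus idm_Bup unfolding setmul3_def by blast
  then show ?thesis using assms closure_subset by (auto simp: torus_orbit_closure_def)
qed

theorem mainTheorem12:
  assumes "\<Omega> \<in> RTSeq n"
  shows "{torus_orbit_closure n g | g. g \<in> GLn n \<and> torus_orbit_closure n g \<subseteq> Xvar \<Omega>}
         = Xvar ` resolutions \<Omega>"
proof -
  let ?xs = "rev \<Omega>"
  let ?I = "{ys. list_all2 resolves ys ?xs}"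
  have valid: "valid ?xs" using RTSeq_valid[OF assms] .
  have len: "length ?xs = n" using assms by (simp add: RTSeq_def)
  have "resolutions \<Omega> = rev ` ?I"
  proof (intro equalityI subsetI)
    fix \<Omega>' assume "\<Omega>' \<in> resolutions \<Omega>"
    then have "rev \<Omega>' \<in> ?I" by (simp add: resolutions_eq)
    then show "\<Omega>' \<in> rev ` ?I" by (metis image_eqI rev_rev_ident)
  next
    fix \<Omega>' assume "\<Omega>' \<in> rev ` ?I"
    then show "\<Omega>' \<in> resolutions \<Omega>" by (auto simp: resolutions_eq list_all2_rev1)
  qed
  then have res: "Xvar ` resolutions \<Omega> = Xr ` ?I" by (simp add: image_image Xvar_eq_Xr)
  have lenI: "length ys = n" "valid ys" if "ys \<in> ?I" for ys
    using that len valid resolves_valid[of ys ?xs] list_all2_lengthD[of resolves ys ?xs] by auto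
  \<comment> \<open>A resolution of a resolution is a resolution, so every cell of the smaller
    variety is among those of the larger.\<close>
  have sub: "Xr ys \<subseteq> Xr ?xs" if ys: "ys \<in> ?I" for ys
  proof -
    have "list_all2 resolves zs ?xs" if "list_all2 resolves zs ys" for zs
      using list_all2_trans[of resolves resolves resolves] resolves_trans that ys by blast
    then show ?thesis
      using Xr_eq_UN_cell[OF valid] Xr_eq_UN_cell[OF lenI(2)[OF ys]] by blast
  qed
  show ?thesis unfolding res Xvar_eq_Xr
  proof (intro equalityI subsetI)
    fix Z assume "Z \<in> {torus_orbit_closure n g | g. g \<in> GLn n \<and> torus_orbit_closure n g \<subseteq> Xr ?xs}"
    then obtain g where g: "g \<in> GLn n" "torus_orbit_closure n g \<subseteq> Xr ?xs" and Z: "Z = torus_orbit_closure n g"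
      by blast
    \<comment> \<open>The orbit closure contains its base point, so the base point lies in some cell
      of the variety, and the word of that cell names the closure.\<close>
    have "g \<in> Xr ?xs" using g mem_torus_orbit_closure by blast
    then obtain ys where ys: "ys \<in> ?I" "g \<in> cell ys" unfolding Xr_eq_UN_cell[OF valid] by blast
    then have "Z = Xr ys" unfolding Z using torus_orbit_closure_cell[of ys g] lenI by auto
    then show "Z \<in> Xr ` ?I" using ys by blast
  next
    fix Z assume "Z \<in> Xr ` ?I"
    then obtain ys where ys: "ys \<in> ?I" and Z: "Z = Xr ys" by blast
    obtain g where g: "g \<in> cell ys" using cell_nonempty by blast
    then have "Z = torus_orbit_closure n g" using Z torus_orbit_closure_cell[of ys g] lenI[OF ys] by auto
    moreover have "g \<in> GLn n" using g cell_GLn[of ys] lenI[OF ys] by auto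
    ultimately show "Z \<in> {torus_orbit_closure n g | g. g \<in> GLn n \<and> torus_orbit_closure n g \<subseteq> Xr ?xs}"
      using sub[OF ys] Z by blast
  qed
qed

end
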